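(* There are absolute constants $c>0$ and $C_0\ge1$ such that for every $n$ and every symmetric norm $l$ on $\mathbb{R}^n$ the following holds. Any (randomized, one-pass) turnstile streaming algorithm that, for every input stream defining a vector $v\in\mathbb{Z}^n$ with $|v_i|\le n^{C_0}$ for all $i$, outputs with probability at least $0.99$ a $(1\pm 1/6)$-approximation to $l(v)$, must use at least $c\cdot\mathrm{mmc}(l)^2$ bits of space in the worst case.
   Context: A norm $l:\mathbb{R}^n\to\mathbb{R}$ is symmetric if $l(Px)=l(x)$ for every permutation matrix $P$ and $l(|x|)=l(x)$, where $|x|$ is the coordinate-wise absolute value. For $k\le n$, $l^{(k)}$ is the norm on $\mathbb{R}^k$ given by $l^{(k)}(x_1,\dots,x_k)=l(x_1,\dots,x_k,0,\dots,0)$. For a norm $l$ on $\mathbb{R}^k$, $\mathfrak{b}_l=\max\{l(x):x\in S^{k-1}\}$, where $S^{k-1}$ is the $\ell_2$ unit sphere, and $\mathrm{M}_l$ is the (unique) median of $l(X)$ for $X$ uniform on $S^{k-1}$, i.e. $\Pr[l(X)\ge \mathrm{M}_l]\ge 1/2$ and $\Pr[l(X)\le \mathrm{M}_l]\ge 1/2$. $\mathrm{mc}(l)=\mathfrak{b}_l/\mathrm{M}_l$ and $\mathrm{mmc}(l)=\max_{1\le k\le n}\mathrm{mc}(l^{(k)})$. Turnstile streaming model: the stream is a sequence of updates $(i,\pm1)$, $i\in[n]$; each update adds $\pm1$ to coordinate $i$ of a vector $v$ that starts at $0$, and the algorithm must output an answer about the final $v$. Coordinates of $v$ are assumed bounded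 in absolute value by $\mathrm{poly}(n)$. The algorithm is randomized, reads the stream once, and its space is the number of bits of working memory (the state carried from one update to the next). A $(1\pm\epsilon)$-approximation to $l(v)$ is a value $\hat l$ with $(1-\epsilon)l(v)\le\hat l\le(1+\epsilon)l(v)$. *)

theory Defs
  imports "HOL-Probability.Probability" "Jordan_Normal_Form.Matrix"
begin

unbundle no vec_syntax
unbundle no inner_syntax

section \<open>Symmetric norms on \<open>R^n\<close>\<close>

text \<open>
  The dimension varies inside the statement, so \<open>R^n\<close> is \<^term>\<open>carrier_vec n\<close>; a norm on
  \<open>R^n\<close> is a function on all real vectors of which only the values on \<^term>\<open>carrier_vec n\<close> matter.
\<close>

definition norm_on :: "nat \<Rightarrow> (real Matrix.vec \<Rightarrow> real) \<Rightarrow> bool" where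
  "norm_on n l \<longleftrightarrow>
     (\<forall>x \<in> carrier_vec n. 0 \<le> l x) \<and>
     (\<forall>x \<in> carrier_vec n. l x = 0 \<longleftrightarrow> x = 0\<^sub>v n) \<and>
     (\<forall>x \<in> carrier_vec n. \<forall>a. l (a \<cdot>\<^sub>v x) = \<bar>a\<bar> * l x) \<and>
     (\<forall>x \<in> carrier_vec n. \<forall>y \<in> carrier_vec n. l (x + y) \<le> l x + l y)"

definition perm_mat :: "nat \<Rightarrow> (nat \<Rightarrow> nat) \<Rightarrow> real mat" where
  "perm_mat n p = mat n n (\<lambda>(i, j). if j = p i then 1 else 0)"

definition symmetric_norm :: "nat \<Rightarrow> (real Matrix.vec \<Rightarrow> real) \<Rightarrow> bool" where
  "symmetric_norm n l \<longleftrightarrow> norm_on n l \<and>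
     (\<forall>p. p permutes {..<n} \<longrightarrow> (\<forall>x \<in> carrier_vec n. l (perm_mat n p *\<^sub>v x) = l x)) \<and>
     (\<forall>x \<in> carrier_vec n. l (map_vec abs x) = l x)"

text \<open>\<open>l^(k)\<close>, for \<open>l\<close> a norm on \<open>R^n\<close> and \<open>k \<le> n\<close>.\<close>

definition restrict_norm :: "nat \<Rightarrow> (real Matrix.vec \<Rightarrow> real) \<Rightarrow> nat \<Rightarrow> real Matrix.vec \<Rightarrow> real" where
  "restrict_norm n l k x = l (x @\<^sub>v 0\<^sub>v (n - k))"

section \<open>The modulus of concentration\<close>

definition unit_sphere :: "nat \<Rightarrow> real Matrix.vec set" where
  "unit_sphere k = {x \<in> carrier_vec k. sqrt (x \<bullet> x) = 1}"

text \<open>Borel sigma-algebra of \<open>R^k\<close>, transported from the product sigma-algebra.\<close>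

definition vec_borel :: "nat \<Rightarrow> real Matrix.vec measure" where
  "vec_borel k = vimage_algebra (carrier_vec k) (\<lambda>x. \<lambda>i\<in>{..<k}. x $ i) (\<Pi>\<^sub>M i\<in>{..<k}. borel)"

text \<open>
  Uniform (rotation invariant) probability distribution on the unit sphere of \<open>R^k\<close>: the law of
  \<open>x / |x|\<close> for \<open>x\<close> uniform in the Euclidean unit ball with respect to Lebesgue measure. (The event
  \<open>x = 0\<close>, where division by zero gives the zero vector, has probability zero for \<open>k \<ge> 1\<close>.)
\<close>

definition uniform_sphere :: "nat \<Rightarrow> real Matrix.vec measure" where
  "uniform_sphere k =
     distr (uniform_measure (\<Pi>\<^sub>M i\<in>{..<k}. lborel)
              {x \<in> space (\<Pi>\<^sub>M i\<in>{..<k}. lborel). sqrt (\<Sum>i<k. (x i)\<^sup>2) \<le> 1})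
           (vec_borel k)
           (\<lambda>x. Matrix.vec k (\<lambda>i. x i / sqrt (\<Sum>j<k. (x j)\<^sup>2)))"

text \<open>The maximum over the sphere is attained for a norm, so it is the supremum.\<close>

definition max_on_sphere :: "nat \<Rightarrow> (real Matrix.vec \<Rightarrow> real) \<Rightarrow> real" where
  "max_on_sphere k l = (SUP x \<in> unit_sphere k. l x)"

definition is_median_on_sphere :: "nat \<Rightarrow> (real Matrix.vec \<Rightarrow> real) \<Rightarrow> real \<Rightarrow> bool" where
  "is_median_on_sphere k l m \<longleftrightarrow>
     \<P>(x in uniform_sphere k. l x \<ge> m) \<ge> 1 / 2 \<and>
     \<P>(x in uniform_sphere k. l x \<le> m) \<ge> 1 / 2"

definition median_on_sphere :: "nat \<Rightarrow> (real Matrix.vec \<Rightarrow> real) \<Rightarrow> real" where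
  "median_on_sphere k l = (THE m. is_median_on_sphere k l m)"

definition mc :: "nat \<Rightarrow> (real Matrix.vec \<Rightarrow> real) \<Rightarrow> real" where
  "mc k l = max_on_sphere k l / median_on_sphere k l"

definition mmc :: "nat \<Rightarrow> (real Matrix.vec \<Rightarrow> real) \<Rightarrow> real" where
  "mmc n l = (MAX k \<in> {1..n}. mc k (restrict_norm n l k))"

section \<open>Turnstile streams and streaming algorithms\<close>

text \<open>The coordinates are numbered from \<open>0\<close> to \<open>n - 1\<close>.\<close>

type_synonym update = "nat \<times> int"

definition streams :: "nat \<Rightarrow> update list set" where
  "streams n = lists ({..<n} \<times> {1, -1})"

definition stream_vec :: "nat \<Rightarrow> update list \<Rightarrow> int Matrix.vec" where
  "stream_vec n us = Matrix.vec n (\<lambda>i. \<Sum>(j, d) \<leftarrow> us. if j = i then d else 0)"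

type_synonym memory = "bool list"

text \<open>
  A randomized one-pass algorithm. Only the memory content is carried from one update to the next
  and counted as space. There are two sources of randomness, neither of which is charged: fresh
  coins at every step (the transitions are probability distributions) and a random string \<open>tape\<close>,
  drawn once and readable at any time. An algorithm without such a string has a constant \<open>tape\<close>.
  No bound is put on computation time, and the algorithm may depend on the dimension and the norm.
\<close>

record stream_alg =
  tape :: "bool list pmf"
  start :: "bool list \<Rightarrow> memory pmf"
  step :: "bool list \<Rightarrow> memory \<Rightarrow> update \<Rightarrow> memory pmf"
  emit :: "bool list \<Rightarrow> memory \<Rightarrow> real pmf"

primrec run_from :: "stream_alg \<Rightarrow> bool list \<Rightarrow> memory \<Rightarrow> update list \<Rightarrow> memory pmf" where
  "run_from A r m [] = return_pmf m"
| "run_from A r m (u # us) = bind_pmf (step A r m u) (\<lambda>m'. run_from A r m' us)"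

definition memory_after :: "stream_alg \<Rightarrow> bool list \<Rightarrow> update list \<Rightarrow> memory pmf" where
  "memory_after A r us = bind_pmf (start A r) (\<lambda>m. run_from A r m us)"

definition answer :: "stream_alg \<Rightarrow> update list \<Rightarrow> real pmf" where
  "answer A us = bind_pmf (tape A) (\<lambda>r. bind_pmf (memory_after A r us) (emit A r))"

text \<open>
  At most \<open>s\<close> bits of memory in the worst case over streams and random choices. Every prefix of a
  stream is itself a stream, so this bounds the memory at every time.
\<close>

definition space_at_most :: "nat \<Rightarrow> stream_alg \<Rightarrow> nat \<Rightarrow> bool" where
  "space_at_most n A s \<longleftrightarrow>
     (\<forall>us \<in> streams n. \<forall>r \<in> set_pmf (tape A). \<forall>m \<in> set_pmf (memory_after A r us). length m \<le> s)"

definition approximates :: "real \<Rightarrow> real \<Rightarrow> real \<Rightarrow> bool" where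
  "approximates \<epsilon> a b \<longleftrightarrow> (1 - \<epsilon>) * b \<le> a \<and> a \<le> (1 + \<epsilon>) * b"

definition solves_norm_approx ::
    "nat \<Rightarrow> (real Matrix.vec \<Rightarrow> real) \<Rightarrow> real \<Rightarrow> real \<Rightarrow> real \<Rightarrow> stream_alg \<Rightarrow> bool" where
  "solves_norm_approx n l B \<epsilon> p A \<longleftrightarrow>
     (\<forall>us \<in> streams n. (\<forall>i<n. \<bar>real_of_int (stream_vec n us $ i)\<bar> \<le> B) \<longrightarrow>
        measure_pmf.prob (answer A us)
          {a. approximates \<epsilon> a (l (map_vec real_of_int (stream_vec n us)))} \<ge> p)"

end

theory Submission
  imports Defs "HOL-Library.Function_Algebras"
begin

text \<open>
  Fix \<open>k\<close>, let \<open>L = l^(k)(1, \<dots>, 1)\<close> and let \<open>x\<close> be an (almost) maximizer of \<open>l^(k)\<close> on the sphere.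
  With \<open>z = \<lfloor>\<alpha> |x|\<rfloor>\<close> and \<open>\<alpha> = 4 L / l^(k)(x)\<close>, a vector in \<open>{0,1}^k\<close> has norm at most \<open>L\<close>, but adding
  any signed permutation of \<open>z\<close> to it raises the norm to at least \<open>2 L\<close>. A uniform point of
  the sphere has many coordinates of order \<open>1 / sqrt k\<close>, so \<open>L\<close> is at most a constant times \<open>sqrt k\<close>
  times the median, and \<open>|z|^2 / k\<close> is at most a constant times \<open>1 / mc(l^(k))^2\<close>.

  Stream \<open>y - e\<close> with \<open>y\<close> uniform in a box and \<open>e\<close> uniform in \<open>{0,1}^k\<close>, and then \<open>-y\<close> or \<open>-(y + z')\<close>, where \<open>z'\<close>
  is \<open>z\<close> with random signs and a random cyclic shift. The algorithm must tell the two cases apart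
  from the memory content \<open>m\<close> after the first part. Let \<open>h(y)\<close> be the vector of the \<open>sqrt (Pr[m | y])\<close>, and
  let \<open>D(w)\<close> be the squared \<open>L2\<close> distance of \<open>h\<close> and its translate by \<open>w\<close>. The inequality
  \<open>D(a + b) + D(a - b) \<le> 2 D(a) + 2 D(b)\<close> makes the random signs decouple the coordinates, so on average
  \<open>D(z')\<close> is at most \<open>|z|^2 / k\<close> times the sum of \<open>D\<close> over the unit vectors. The latter is the sum of the Hellinger distances
  between \<open>m\<close> and \<open>m\<close> given one bit of \<open>e\<close>, which the entropy of \<open>m\<close> bounds by the space.
\<close>

section \<open>Entropy and Hellinger distance on the cube\<close>

text \<open>Subsets of \<open>I\<close> encode the points of the cube {0,1}^I, so that setting a bit
  is \<open>insert\<close>.\<close>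

definition avg :: "'i set \<Rightarrow> ('i set \<Rightarrow> real) \<Rightarrow> real" where
  "avg I f = (\<Sum>S\<in>Pow I. f S) / 2 ^ card I"

text \<open>Both arguments are compared with their midpoint, not with each other, because averaging
  over one bit of \<open>e\<close> produces exactly this midpoint.\<close>

definition hellinger :: "real \<Rightarrow> real \<Rightarrow> real" where
  "hellinger a b = (sqrt a - sqrt ((a + b) / 2))\<^sup>2 + (sqrt b - sqrt ((a + b) / 2))\<^sup>2"

definition xlogx :: "real \<Rightarrow> real" where
  "xlogx x = x * ln x"

lemma avg_empty [simp]: "avg {} f = f {}"
  by (simp add: avg_def)

lemma avg_insert:
  assumes "finite I" "i \<notin> I"
  shows "avg (insert i I) f = (avg I f + avg I (\<lambda>S. f (insert i S))) / 2"
proof -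
  have inj: "inj_on (insert i) (Pow I)"
    using assms(2) by (auto simp: inj_on_def)
  have "(\<Sum>S\<in>Pow (insert i I). f S) = (\<Sum>S\<in>Pow I. f S) + (\<Sum>S\<in>insert i ` Pow I. f S)"
    unfolding Pow_insert using assms by (intro sum.union_disjoint) auto
  also have "(\<Sum>S\<in>insert i ` Pow I. f S) = (\<Sum>S\<in>Pow I. f (insert i S))"
    using inj by (subst sum.reindex) auto
  finally show ?thesis
    using assms by (simp add: avg_def add_divide_distrib)
qed

lemma avg_split:
  assumes "finite I" "i \<in> I"
  shows "avg I f = (avg (I - {i}) f + avg (I - {i}) (\<lambda>S. f (insert i S))) / 2"
  using avg_insert[of "I - {i}" i f] assms by (simp add: insert_absorb)

lemma avg_const: "finite I \<Longrightarrow> avg I (\<lambda>_. c) = c"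
  by (simp add: avg_def card_Pow)

lemma avg_mono: "(\<And>S. S \<subseteq> I \<Longrightarrow> f S \<le> g S) \<Longrightarrow> avg I f \<le> avg I g"
  by (auto simp: avg_def intro!: divide_right_mono sum_mono)

lemma avg_nonneg: "(\<And>S. S \<subseteq> I \<Longrightarrow> 0 \<le> f S) \<Longrightarrow> 0 \<le> avg I f"
  by (auto simp: avg_def intro!: divide_nonneg_nonneg sum_nonneg)

lemma avg_sum: "avg I (\<lambda>S. \<Sum>a\<in>A. f a S) = (\<Sum>a\<in>A. avg I (f a))"
  unfolding avg_def by (subst sum.swap) (simp add: sum_divide_distrib)

lemma avg_cmult: "avg I (\<lambda>S. c * f S) = c * avg I f"
  by (simp add: avg_def sum_distrib_left)

lemma avg_add: "avg I (\<lambda>S. f S + g S) = avg I f + avg I g"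
  by (simp add: avg_def sum.distrib add_divide_distrib)

section \<open>Convexity of the Hellinger term and its comparison with entropy\<close>

lemma hellinger_eq:
  assumes "0 \<le> a" "0 \<le> b"
  shows "hellinger a b = 2 * (a + b) - 2 * sqrt ((a + b) / 2) * (sqrt a + sqrt b)"
proof -
  have "(sqrt ((a + b) / 2))\<^sup>2 = (a + b) / 2" "(sqrt a)\<^sup>2 = a" "(sqrt b)\<^sup>2 = b"
    using assms by simp_all
  then show ?thesis unfolding hellinger_def power2_diff by (simp add: field_simps)
qed

text \<open>Cauchy-Schwarz for the vectors (sqrt a, sqrt c) and (sqrt b, sqrt d).\<close>

lemma sqrt_mult_superadd:
  fixes a b c d :: real
  assumes "0 \<le> a" "0 \<le> b" "0 \<le> c" "0 \<le> d"
  shows "sqrt a * sqrt b + sqrt c * sqrt d \<le> sqrt (a + c) * sqrt (b + d)"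
proof -
  have "(sqrt a * sqrt b + sqrt c * sqrt d)\<^sup>2 \<le> (a + c) * (b + d)"
  proof -
    have "2 * (sqrt a * sqrt d) * (sqrt b * sqrt c) \<le> (sqrt a * sqrt d)\<^sup>2 + (sqrt b * sqrt c)\<^sup>2"
      by (rule sum_squares_bound)
    then show ?thesis using assms by (simp add: power2_eq_square algebra_simps)
  qed
  then have "sqrt a * sqrt b + sqrt c * sqrt d \<le> sqrt ((a + c) * (b + d))"
    by (rule real_le_rsqrt)
  then show ?thesis by (simp add: real_sqrt_mult)
qed

text \<open>By \<open>hellinger_eq\<close> the value is a linear term minus geometric means of the
  midpoint with each argument, and geometric means are jointly concave by
  \<open>sqrt_mult_superadd\<close>.\<close>

lemma hellinger_convex:
  assumes "0 \<le> a" "0 \<le> b" "0 \<le> c" "0 \<le> d"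
  shows "hellinger ((a + c) / 2) ((b + d) / 2) \<le> (hellinger a b + hellinger c d) / 2"
proof -
  define m m' where "m = (a + b) / 2" and "m' = (c + d) / 2"
  have mm: "((a + c) / 2 + (b + d) / 2) / 2 = (m + m') / 2"
    by (simp add: m_def m'_def field_simps)
  have h: "sqrt (x / 2) * sqrt (y / 2) = sqrt x * sqrt y / 2" for x y :: real
    by (simp add: real_sqrt_divide)
  have nn: "0 \<le> m" "0 \<le> m'" using assms by (auto simp: m_def m'_def)
  have 1: "sqrt m * sqrt a + sqrt m' * sqrt c \<le> sqrt (m + m') * sqrt (a + c)"
    using nn assms by (intro sqrt_mult_superadd)
  have 2: "sqrt m * sqrt b + sqrt m' * sqrt d \<le> sqrt (m + m') * sqrt (b + d)"
    using nn assms by (intro sqrt_mult_superadd)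
  have "hellinger ((a + c) / 2) ((b + d) / 2) = (a + b + c + d) - (sqrt (m + m') * sqrt (a + c) + sqrt (m + m') * sqrt (b + d))"
  proof -
    have "hellinger ((a + c) / 2) ((b + d) / 2) = 2 * ((a + c) / 2 + (b + d) / 2)
        - 2 * (sqrt ((m + m') / 2) * (sqrt ((a + c) / 2) + sqrt ((b + d) / 2)))"
      using hellinger_eq[of "(a + c) / 2" "(b + d) / 2"] assms by (simp only: mm mult.assoc) simp
    then show ?thesis by (simp only: distrib_left h) argo
  qed
  moreover have "hellinger a b = 2 * (a + b) - 2 * (sqrt m * sqrt a + sqrt m * sqrt b)"
    "hellinger c d = 2 * (c + d) - 2 * (sqrt m' * sqrt c + sqrt m' * sqrt d)"
    using assms by (simp_all add: hellinger_eq m_def m'_def algebra_simps)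
  ultimately show ?thesis using 1 2 by simp
qed

text \<open>The inequality ln t \<le> t - 1 at t = sqrt (c / a), multiplied by 2a.\<close>

lemma ln_sqrt_ineq:
  fixes a c :: real
  assumes "0 < a" "0 < c"
  shows "2 * a - 2 * (sqrt a * sqrt c) \<le> a * ln a - a * ln c"
proof -
  have "ln (sqrt (c / a)) \<le> sqrt (c / a) - 1"
    using assms by (intro ln_le_minus_one) auto
  then have "(ln c - ln a) / 2 \<le> sqrt (c / a) - 1"
    using assms by (simp add: ln_sqrt ln_div)
  then have "a * ((ln c - ln a) / 2) \<le> a * (sqrt (c / a) - 1)"
    using assms by (intro mult_left_mono) auto
  moreover have "a * sqrt (c / a) = sqrt a * sqrt c"
  proof -
    have "a * sqrt (c / a) = sqrt a * sqrt a * (sqrt c / sqrt a)"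
      using assms by (simp add: real_sqrt_divide)
    also have "\<dots> = sqrt a * sqrt c"
      using assms by (simp add: field_simps del: real_sqrt_mult_self)
    finally show ?thesis .
  qed
  ultimately show ?thesis by (simp add: field_simps)
qed

text \<open>Add \<open>ln_sqrt_ineq\<close> for \<open>a\<close> and for \<open>b\<close>, with
  \<open>c\<close> their midpoint: the left sides add up to \<open>hellinger a b\<close>, the right
  sides to twice the Jensen gap of x ln x.\<close>

lemma hellinger_le_entropy:
  assumes "0 \<le> a" "0 \<le> b"
  shows "hellinger a b / 2 \<le> (xlogx a + xlogx b) / 2 - xlogx ((a + b) / 2)"
proof (cases "a + b = 0")
  case True
  then have "a = 0" "b = 0" using assms by auto
  then show ?thesis by (simp add: hellinger_def xlogx_def)
next
  case False
  define c where "c = (a + b) / 2"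
  have c: "c > 0" using False assms by (auto simp: c_def)
  have *: "2 * x - 2 * (sqrt x * sqrt c) \<le> xlogx x - x * ln c" if "0 \<le> x" for x
    using ln_sqrt_ineq[of x c] c that by (cases "x = 0") (auto simp: xlogx_def)
  have "hellinger a b = 2 * (a + b) - 2 * (sqrt a * sqrt c) - 2 * (sqrt b * sqrt c)"
    using assms by (simp add: hellinger_eq c_def algebra_simps)
  also have "\<dots> \<le> xlogx a + xlogx b - (a + b) * ln c"
    using *[OF assms(1)] *[OF assms(2)] by (simp add: algebra_simps)
  also have "(a + b) * ln c = 2 * xlogx c"
    by (simp add: xlogx_def c_def)
  finally show ?thesis by (simp add: c_def field_simps)
qed

text \<open>A chain rule, by induction on the number of bits. The Jensen gap on the larger cube is
  the mean of the gaps on its two halves plus the gap between the two half averages. The latter pays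
  for the new bit; convexity of \<open>hellinger\<close> passes the terms of the old bits to the
  halves.\<close>

lemma sum_hellinger_le_entropy:
  assumes "finite I" "\<And>S. 0 \<le> f S"
  shows "(\<Sum>j\<in>I. hellinger (avg (I - {j}) f) (avg (I - {j}) (\<lambda>S. f (insert j S))))
           \<le> 2 * (avg I (\<lambda>S. xlogx (f S)) - xlogx (avg I f))"
  using assms
proof (induction I arbitrary: f rule: finite_induct)
  case empty
  then show ?case by simp
next
  case (insert i I)
  define g where "g = (\<lambda>S. f (insert i S))"
  have fg: "\<And>S. 0 \<le> f S" "\<And>S. 0 \<le> g S" using insert.prems by (auto simp: g_def)
  let ?H = "\<lambda>f j. hellinger (avg (I - {j}) f) (avg (I - {j}) (\<lambda>S. f (insert j S)))"
  have step: "hellinger (avg (insert i I - {j}) f) (avg (insert i I - {j}) (\<lambda>S. f (insert j S)))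
      \<le> (?H f j + ?H g j) / 2" if "j \<in> I" for j
  proof -
    have eq: "insert i I - {j} = insert i (I - {j})" using that insert.hyps by auto
    have notin: "i \<notin> I - {j}" using insert.hyps by auto
    have sw: "insert j (insert i S) = insert i (insert j S)" for S by auto
    show ?thesis
      unfolding eq avg_insert[OF finite_Diff[OF insert.hyps(1)], of i "{j}", OF notin] sw g_def
      by (intro hellinger_convex avg_nonneg insert.prems)
  qed
  have i: "insert i I - {i} = I" using insert.hyps by auto
  have "(\<Sum>j\<in>insert i I. hellinger (avg (insert i I - {j}) f) (avg (insert i I - {j}) (\<lambda>S. f (insert j S))))
     \<le> hellinger (avg I f) (avg I g) + (\<Sum>j\<in>I. (?H f j + ?H g j) / 2)"
    using insert.hyps by (auto simp: i g_def intro!: sum_mono step[unfolded g_def])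
  also have "(\<Sum>j\<in>I. (?H f j + ?H g j) / 2) = (\<Sum>j\<in>I. ?H f j) / 2 + (\<Sum>j\<in>I. ?H g j) / 2"
    by (simp add: sum.distrib sum_divide_distrib add_divide_distrib)
  also have "\<dots> \<le> (avg I (\<lambda>S. xlogx (f S)) - xlogx (avg I f)) + (avg I (\<lambda>S. xlogx (g S)) - xlogx (avg I g))"
    using insert.IH[of f] insert.IH[of g] fg by auto
  also have "hellinger (avg I f) (avg I g) \<le> xlogx (avg I f) + xlogx (avg I g) - 2 * xlogx ((avg I f + avg I g) / 2)"
    using hellinger_le_entropy[of "avg I f" "avg I g", OF avg_nonneg avg_nonneg, OF fg] by argo
  finally show ?case
    using insert.hyps by (simp add: avg_insert g_def add_divide_distrib)
qed

text \<open>Comparison with the uniform distribution: ln t \<le> t - 1 at t = 1 / (K p). Stated with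
  \<open>K\<close> in place of the cardinality because only an upper bound on the number of memory
  contents will be at hand.\<close>

lemma gibbs_finite:
  assumes "finite A" "\<And>m. m \<in> A \<Longrightarrow> 0 \<le> p m" "(\<Sum>m\<in>A. p m) = 1" "real (card A) \<le> K"
  shows "(\<Sum>m\<in>A. - xlogx (p m)) \<le> ln K"
proof -
  have "A \<noteq> {}" using assms(3) by auto
  then have "card A > 0" using assms(1) by (simp add: card_gt_0_iff)
  then have K: "K > 0" using assms(4) by linarith
  have "- xlogx (p m) \<le> p m * ln K + (1 / K - p m)" if "m \<in> A" for m
  proof (cases "p m = 0")
    case True
    then show ?thesis using K by (simp add: xlogx_def)
  next
    case False
    then have p: "p m > 0" using assms(2)[OF that] by auto
    have "ln (1 / (K * p m)) \<le> 1 / (K * p m) - 1"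
      using p K by (intro ln_le_minus_one) auto
    then have "p m * ln (1 / (K * p m)) \<le> p m * (1 / (K * p m) - 1)"
      using p by (intro mult_left_mono) auto
    also have "\<dots> = 1 / K - p m"
      using p K by (simp add: right_diff_distrib)
    also have "p m * ln (1 / (K * p m)) = - xlogx (p m) - p m * ln K"
      using p K by (simp add: xlogx_def ln_div ln_mult algebra_simps)
    finally show ?thesis by simp
  qed
  then have "(\<Sum>m\<in>A. - xlogx (p m)) \<le> (\<Sum>m\<in>A. p m * ln K + (1 / K - p m))"
    by (intro sum_mono)
  also have "\<dots> = ln K + (real (card A) / K - 1)"
    by (simp add: sum.distrib sum_subtractf assms(3) flip: sum_distrib_right)
  also have "\<dots> \<le> ln K"
    using assms(4) K by simp
  finally show ?thesis .
qed

text \<open>Summed over \<open>m\<close>, the right side of \<open>sum_hellinger_le_entropy\<close>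
  is twice the mutual information of \<open>S\<close> and \<open>m\<close>. Its conditional part is
  at most 0 and is dropped, which leaves the entropy of \<open>m\<close>.\<close>

lemma sum_hellinger_le_ln_card:
  fixes P :: "'i set \<Rightarrow> 'm \<Rightarrow> real"
  assumes "finite I" "finite A" "\<And>S m. 0 \<le> P S m" "\<And>S. (\<Sum>m\<in>A. P S m) = 1" "real (card A) \<le> K"
  shows "(\<Sum>m\<in>A. \<Sum>j\<in>I. hellinger (avg (I - {j}) (\<lambda>S. P S m)) (avg (I - {j}) (\<lambda>S. P (insert j S) m)))
           \<le> 2 * ln K"
proof -
  have le1: "P S m \<le> 1" if "m \<in> A" for S m
    using member_le_sum[of m A "P S"] assms that by auto
  have "(\<Sum>j\<in>I. hellinger (avg (I - {j}) (\<lambda>S. P S m)) (avg (I - {j}) (\<lambda>S. P (insert j S) m)))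
     \<le> 2 * (- xlogx (avg I (\<lambda>S. P S m)))" if "m \<in> A" for m
  proof -
    have "xlogx (P S m) \<le> 0" for S
      using le1[OF that, of S] assms(3)[of S m]
      by (cases "P S m = 0") (auto simp: xlogx_def mult_le_0_iff)
    then have "avg I (\<lambda>S. xlogx (P S m)) \<le> avg I (\<lambda>_. 0)"
      by (intro avg_mono)
    then show ?thesis
      using sum_hellinger_le_entropy[of I "\<lambda>S. P S m"] assms(1,3) by (simp add: avg_const)
  qed
  then have "(\<Sum>m\<in>A. \<Sum>j\<in>I. hellinger (avg (I - {j}) (\<lambda>S. P S m)) (avg (I - {j}) (\<lambda>S. P (insert j S) m)))
     \<le> (\<Sum>m\<in>A. 2 * (- xlogx (avg I (\<lambda>S. P S m))))"
    by (intro sum_mono)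
  also have "\<dots> = 2 * (\<Sum>m\<in>A. - xlogx (avg I (\<lambda>S. P S m)))"
    by (rule sum_distrib_left [symmetric])
  also have "(\<Sum>m\<in>A. - xlogx (avg I (\<lambda>S. P S m))) \<le> ln K"
    using assms
    by (intro gibbs_finite) (auto intro!: avg_nonneg simp: avg_const simp flip: avg_sum)
  finally show ?thesis by simp
qed

section \<open>Translates of finitely supported functions\<close>

text \<open>Finite support makes the sums below converge, while summing over the whole group makes
  translation invariance exact.\<close>

definition fin_supp :: "('a \<Rightarrow> real) \<Rightarrow> bool" where
  "fin_supp f \<longleftrightarrow> finite {y. f y \<noteq> 0}"

lemma fin_supp_summable: "fin_supp f \<Longrightarrow> f summable_on UNIV"
  unfolding fin_supp_def
  by (rule summable_on_cong_neutral[THEN iffD1, OF _ _ _ summable_on_finite[of "{y. f y \<noteq> 0}" f]]) auto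

lemma fin_supp_add: "fin_supp f \<Longrightarrow> fin_supp g \<Longrightarrow> fin_supp (\<lambda>y. f y + g y)"
  unfolding fin_supp_def by (rule finite_subset[of _ "{y. f y \<noteq> 0} \<union> {y. g y \<noteq> 0}"]) auto

lemma fin_supp_diff: "fin_supp f \<Longrightarrow> fin_supp g \<Longrightarrow> fin_supp (\<lambda>y. f y - g y)"
  unfolding fin_supp_def by (rule finite_subset[of _ "{y. f y \<noteq> 0} \<union> {y. g y \<noteq> 0}"]) auto

lemma fin_supp_cmult: "fin_supp f \<Longrightarrow> fin_supp (\<lambda>y. c * f y)"
  unfolding fin_supp_def by (rule finite_subset[of _ "{y. f y \<noteq> 0}"]) auto

lemma fin_supp_power2: "fin_supp f \<Longrightarrow> fin_supp (\<lambda>y. (f y)\<^sup>2)"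
  unfolding fin_supp_def by simp

lemma fin_supp_mult: "fin_supp f \<Longrightarrow> fin_supp (\<lambda>y. f y * g y)"
  unfolding fin_supp_def by (rule finite_subset[of _ "{y. f y \<noteq> 0}"]) auto

lemma fin_supp_restrict: "finite B \<Longrightarrow> fin_supp (\<lambda>y. if y \<in> B then f y else 0)"
  unfolding fin_supp_def by (rule finite_subset[of _ B]) auto

lemma fin_supp_shift:
  fixes f :: "'g::ab_group_add \<Rightarrow> real"
  assumes "fin_supp f"
  shows "fin_supp (\<lambda>y. f (y - z))"
proof -
  have "{y. f (y - z) \<noteq> 0} = (\<lambda>y. y + z) ` {y. f y \<noteq> 0}"
    by (force simp: image_iff intro: exI[of _ "_ - z"])
  then show ?thesis using assms by (simp add: fin_supp_def)
qed

lemmas fin_supp_intros =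
  fin_supp_add fin_supp_diff fin_supp_cmult fin_supp_power2 fin_supp_mult fin_supp_shift fin_supp_restrict

lemma infsum_restrict:
  "finite B \<Longrightarrow> infsum (\<lambda>y. if y \<in> B then f y else 0) UNIV = (\<Sum>y\<in>B. f y :: real)"
  by (rule trans[OF infsum_cong_neutral[where T = B and g = f]]) auto

lemma infsum_shift:
  fixes f :: "'g::ab_group_add \<Rightarrow> real"
  shows "infsum (\<lambda>y. f (y - z)) UNIV = infsum f UNIV"
proof (rule infsum_reindex_bij_betw)
  show "bij_betw (\<lambda>y. y - z) UNIV (UNIV :: 'g set)"
    by (rule bij_betwI[where g = "\<lambda>y. y + z"]) auto
qed

lemma infsum_add_fin_supp:
  "fin_supp f \<Longrightarrow> fin_supp g \<Longrightarrow> infsum (\<lambda>y. f y + g y) UNIV = infsum f UNIV + infsum g UNIV"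
  by (intro infsum_add fin_supp_summable)

lemma infsum_mono_fin_supp:
  "fin_supp f \<Longrightarrow> fin_supp g \<Longrightarrow> (\<And>y. f y \<le> g y) \<Longrightarrow> infsum f UNIV \<le> infsum g UNIV"
  by (intro infsum_mono fin_supp_summable) auto

lemma infsum_cmult: "infsum (\<lambda>y. c * f y) UNIV = c * infsum (f :: 'a \<Rightarrow> real) UNIV"
  by (rule infsum_cmult_right')

section \<open>Squared distance of a function to its translates\<close>

definition shift_dist :: "('g::ab_group_add \<Rightarrow> real) \<Rightarrow> 'g \<Rightarrow> real" where
  "shift_dist h z = infsum (\<lambda>y. (h y - h (y - z))\<^sup>2) UNIV"

lemma shift_dist_zero [simp]: "shift_dist h 0 = 0"
  by (simp add: shift_dist_def)

text \<open>The squared sides minus the squared diagonals of a quadrilateral p, q, r, s amount to (p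
  - q + r - s)^2.\<close>

lemma quadrilateral_ineq:
  fixes p q r s :: real
  shows "(p - r)\<^sup>2 + (q - s)\<^sup>2 \<le> (p - q)\<^sup>2 + (q - r)\<^sup>2 + (r - s)\<^sup>2 + (p - s)\<^sup>2"
proof -
  have "0 \<le> (p - q + r - s)\<^sup>2" by simp
  then show ?thesis by (simp add: power2_eq_square algebra_simps)
qed

text \<open>\<open>quadrilateral_ineq\<close> at the values of \<open>h\<close> at y, y - a, y - (a
  + b), y - b, summed over y: the diagonals are steps by a + b and a - b, the sides are steps by a
  and b, each occurring twice.\<close>

lemma shift_dist_parallelogram:
  assumes "fin_supp h"
  shows "shift_dist h (a + b) + shift_dist h (a - b) \<le> 2 * shift_dist h a + 2 * shift_dist h b"
proof -
  let ?D = "\<lambda>z. \<lambda>y. (h y - h (y - z))\<^sup>2"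
  have fs: "fin_supp (?D z)" for z using assms by (intro fin_supp_intros)
  have fs': "fin_supp (\<lambda>y. ?D z (y - w))" for z w by (rule fin_supp_shift[OF fs])
  \<comment> \<open>The terms are offset so that all six belong to the same parallelogram;
    \<open>infsum_shift\<close> removes the offsets afterwards.\<close>
  have "infsum (\<lambda>y. ?D (a + b) y + ?D (a - b) (y - b)) UNIV
    \<le> infsum (\<lambda>y. ?D a y + ?D b (y - a) + ?D a (y - b) + ?D b y) UNIV"
  proof (intro infsum_mono_fin_supp fin_supp_add fs fs')
    fix y
    have [simp]: "y - b - (a - b) = y - a" "y - b - a = y - (a + b)" "y - a - b = y - (a + b)"
      by (simp_all add: algebra_simps)
    show "?D (a + b) y + ?D (a - b) (y - b) \<le> ?D a y + ?D b (y - a) + ?D a (y - b) + ?D b y"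
      using quadrilateral_ineq[of "h y" "h (y - (a + b))" "h (y - a)" "h (y - b)"]
      by (simp add: power2_commute add_ac)
  qed
  then show ?thesis
    by (simp only: infsum_add_fin_supp fin_supp_add fs fs' infsum_shift[of "?D (a - b)" b]
        infsum_shift[of "?D b" a] infsum_shift[of "?D a" b] shift_dist_def)
qed

lemma power2_add_le:
  fixes x y t :: real
  assumes "t > 0"
  shows "(x + y)\<^sup>2 \<le> (1 + 1 / t) * x\<^sup>2 + (1 + t) * y\<^sup>2"
proof -
  have "0 \<le> (x - t * y)\<^sup>2 / t" using assms by simp
  also have "\<dots> = x\<^sup>2 / t - 2 * x * y + t * y\<^sup>2"
    using assms by (simp add: power2_eq_square field_simps)
  finally show ?thesis by (simp add: power2_sum field_simps)
qed

lemma shift_dist_add: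
  assumes "fin_supp h" "t > 0"
  shows "shift_dist h (a + b) \<le> (1 + 1 / t) * shift_dist h a + (1 + t) * shift_dist h b"
proof -
  let ?D = "\<lambda>z. \<lambda>y. (h y - h (y - z))\<^sup>2"
  have fs: "fin_supp (?D z)" for z using assms(1) by (intro fin_supp_intros)
  have fs': "fin_supp (\<lambda>y. ?D z (y - w))" for z w by (rule fin_supp_shift[OF fs])
  have "infsum (?D (a + b)) UNIV \<le> infsum (\<lambda>y. (1 + 1 / t) * ?D a y + (1 + t) * ?D b (y - a)) UNIV"
  proof (intro infsum_mono_fin_supp fin_supp_add fin_supp_cmult fs fs')
    fix y
    show "?D (a + b) y \<le> (1 + 1 / t) * ?D a y + (1 + t) * ?D b (y - a)"
      using power2_add_le[OF assms(2), of "h y - h (y - a)" "h (y - a) - h (y - a - b)"]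
      by (simp add: diff_diff_eq)
  qed
  then show ?thesis
    by (simp add: infsum_add_fin_supp fin_supp_cmult fs fs' infsum_cmult infsum_shift[of "?D _"]
        flip: shift_dist_def)
qed

text \<open>Adding one copy to \<open>m\<close> copies by \<open>shift_dist_add\<close> with weight
  t = m loses nothing, since (1 + 1/m) m^2 + (1 + m) = (m + 1)^2.\<close>

lemma shift_dist_multiple:
  assumes "fin_supp h"
  shows "shift_dist h (\<Sum>i<m. a) \<le> (real m)\<^sup>2 * shift_dist h a"
proof (induction m)
  case (Suc m)
  show ?case
  proof (cases "m = 0")
    case False
    have "shift_dist h (\<Sum>i<Suc m. a) \<le> (1 + 1 / real m) * shift_dist h (\<Sum>i<m. a) + (1 + real m) * shift_dist h a"
      using shift_dist_add[OF assms, of "real m" "\<Sum>i<m. a" a] False by simp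
    also have "\<dots> \<le> (1 + 1 / real m) * ((real m)\<^sup>2 * shift_dist h a) + (1 + real m) * shift_dist h a"
      using Suc.IH by (intro add_right_mono mult_left_mono) auto
    also have "\<dots> = (real (Suc m))\<^sup>2 * shift_dist h a"
      using False by (simp add: power2_eq_square field_simps)
    finally show ?thesis .
  qed simp
qed simp

text \<open>Averaging over the sign of \<open>w i\<close> pairs the translates by V + w i and V - w
  i, and \<open>shift_dist_parallelogram\<close> bounds the pair without a cross term. The triangle
  inequality alone would cost a factor \<open>card I\<close>.\<close>

lemma avg_shift_dist_signs:
  assumes "fin_supp h" "finite I"
  shows "avg I (\<lambda>S. shift_dist h (\<Sum>j\<in>I. if j \<in> S then - w j else w j)) \<le> (\<Sum>j\<in>I. shift_dist h (w j))"
  using assms(2)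
proof (induction I rule: finite_induct)
  case empty
  then show ?case by simp
next
  case (insert i I)
  let ?V = "\<lambda>S. \<Sum>j\<in>I. if j \<in> S then - w j else w j"
  have 1: "avg I (\<lambda>S. shift_dist h (\<Sum>j\<in>insert i I. if j \<in> S then - w j else w j))
     = avg I (\<lambda>S. shift_dist h (?V S + w i))"
    unfolding avg_def using insert.hyps
    by (intro arg_cong2[where f = "(/)"] sum.cong) (auto simp: add.commute)
  have V: "?V (insert i S) = ?V S" for S
    using insert.hyps by (intro sum.cong) auto
  have 2: "avg I (\<lambda>S. shift_dist h (\<Sum>j\<in>insert i I. if j \<in> insert i S then - w j else w j))
     = avg I (\<lambda>S. shift_dist h (?V S - w i))"
    using insert.hyps by (simp add: V del: insert_iff) (simp add: algebra_simps)
  have "avg (insert i I) (\<lambda>S. shift_dist h (\<Sum>j\<in>insert i I. if j \<in> S then - w j else w j))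
     = avg I (\<lambda>S. shift_dist h (?V S + w i) + shift_dist h (?V S - w i)) / 2"
    by (simp only: avg_insert[OF insert.hyps] 1 2 avg_add)
  also have "\<dots> \<le> avg I (\<lambda>S. 2 * shift_dist h (?V S) + 2 * shift_dist h (w i)) / 2"
    by (intro divide_right_mono avg_mono shift_dist_parallelogram assms) auto
  also have "\<dots> = avg I (\<lambda>S. shift_dist h (?V S)) + shift_dist h (w i)"
    using insert.hyps by (simp add: avg_add avg_cmult avg_const)
  finally show ?case using insert by simp
qed

section \<open>Distinguishing translates of a hidden lattice point\<close>

text \<open>The default value 0 outside the first \<open>k\<close> coordinates keeps the box inside
  the additive group of functions on \<open>nat\<close>, so its points can be translated.\<close>

definition lattice_box :: "nat \<Rightarrow> int \<Rightarrow> (nat \<Rightarrow> int) set" where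
  "lattice_box k N = PiE_dflt {..<k} 0 (\<lambda>_. {0..<N})"

definition unit_at :: "nat \<Rightarrow> nat \<Rightarrow> int" where
  "unit_at j = (\<lambda>i. if i = j then 1 else 0)"

definition indic :: "nat set \<Rightarrow> nat \<Rightarrow> int" where
  "indic S = (\<lambda>i. if i \<in> S then 1 else 0)"

lemma lattice_box_iff:
  "y \<in> lattice_box k N \<longleftrightarrow> (\<forall>i. (i < k \<longrightarrow> 0 \<le> y i \<and> y i < N) \<and> (i \<ge> k \<longrightarrow> y i = 0))"
  by (auto simp: lattice_box_def PiE_dflt_def not_less)

lemma finite_lattice_box [simp]: "finite (lattice_box k N)"
  unfolding lattice_box_def by (intro finite_PiE_dflt) auto

lemma card_lattice_box: "card (lattice_box k N) = nat N ^ k"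
  unfolding lattice_box_def by (subst card_PiE_dflt) auto

text \<open>A face has a fraction 1 / N of the points. For the side N = k used below, the
  \<open>k\<close> faces on one side together have as many points as the box.\<close>

lemma card_lattice_box_face:
  assumes "j < k" "0 \<le> a" "a < N"
  shows "card {y \<in> lattice_box k N. y j = a} = nat N ^ (k - 1)"
proof -
  have "{y \<in> lattice_box k N. y j = a} = PiE_dflt {..<k} 0 (\<lambda>i. if i = j then {a} else {0..<N})"
    using assms by (auto simp: lattice_box_def PiE_dflt_def split: if_splits)
  then have "card {y \<in> lattice_box k N. y j = a} = (\<Prod>i<k. if i = j then 1 else nat N)"
    by (simp add: card_PiE_dflt if_distrib cong: if_cong)
  also have "\<dots> = nat N ^ (k - 1)"
    using assms by (subst prod.remove[of _ j]) (auto simp: if_distrib)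
  finally show ?thesis .
qed

text \<open>If \<open>P x m\<close> is the probability of memory \<open>m\<close> after streaming
  \<open>x\<close>, this is the probability of \<open>m\<close> after streaming y - e, for given
  \<open>y\<close> and uniform \<open>e\<close> in the cube.\<close>

definition cube_average :: "nat \<Rightarrow> ((nat \<Rightarrow> int) \<Rightarrow> 'm \<Rightarrow> real) \<Rightarrow> (nat \<Rightarrow> int) \<Rightarrow> 'm \<Rightarrow> real" where
  "cube_average k P y m = avg {..<k} (\<lambda>S. P (y - indic S) m)"

definition signed_shift :: "nat \<Rightarrow> (nat \<Rightarrow> nat) \<Rightarrow> nat \<Rightarrow> nat set \<Rightarrow> nat \<Rightarrow> int" where
  "signed_shift k z c S = (\<lambda>i. if i < k then (if i \<in> S then - 1 else 1) * int (z ((i + c) mod k)) else 0)"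

lemma bij_cyclic: "bij_betw (\<lambda>c. (j + c) mod k) {..<k} {..<k :: nat}"
proof (rule bij_betw_imageI)
  show "inj_on (\<lambda>c. (j + c) mod k) {..<k}"
  proof (rule inj_onI)
    fix a b
    show "a = b" if ab: "a \<in> {..<k}" "b \<in> {..<k}" "(j + a) mod k = (j + b) mod k"
    proof -
      from ab(3) have "int (j + a) mod int k = int (j + b) mod int k"
        by (metis of_nat_mod)
      then have "int k dvd int a - int b"
        by (simp add: mod_eq_dvd_iff)
      then show "a = b"
        using dvd_imp_le_int[of "int a - int b" "int k"] ab by fastforce
    qed
  qed
  then have "card ((\<lambda>c. (j + c) mod k) ` {..<k}) = k"
    by (simp add: card_image)
  then show "(\<lambda>c. (j + c) mod k) ` {..<k} = {..<k}"
    by (intro card_subset_eq) (auto intro: mod_less_divisor)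
qed

lemma sum_cyclic: "(\<Sum>c<k. f ((j + c) mod k)) = (\<Sum>i<k. f i :: real)" for k :: nat
  by (rule sum.reindex_bij_betw[OF bij_cyclic])

section \<open>A channel with few outputs, and translates of its hidden input\<close>

context
  fixes k :: nat and P :: "(nat \<Rightarrow> int) \<Rightarrow> 'm \<Rightarrow> real" and A :: "'m set" and K :: real
  assumes k: "k \<ge> 1"
    and finA: "finite A"
    and P_nonneg: "\<And>x m. 0 \<le> P x m"
    and P_sum: "\<And>x. (\<Sum>m\<in>A. P x m) = 1"
    and K: "real (card A) \<le> K"
begin

abbreviation smoothed :: "(nat \<Rightarrow> int) \<Rightarrow> 'm \<Rightarrow> real" where
  "smoothed \<equiv> cube_average k P"

text \<open>Square roots make \<open>shift_dist\<close> a Hellinger distance. The side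
  \<open>k\<close> of the box is large enough that the boundary, over all unit directions, costs
  only twice the total mass.\<close>

definition amplitude :: "'m \<Rightarrow> (nat \<Rightarrow> int) \<Rightarrow> real" where
  "amplitude m y = (if y \<in> lattice_box k k then sqrt (smoothed y m) else 0)"

text \<open>The probability of \<open>m\<close> given \<open>y\<close> and given that bit
  \<open>j\<close> of \<open>e\<close> is 0.\<close>

definition half_smoothed :: "nat \<Rightarrow> (nat \<Rightarrow> int) \<Rightarrow> 'm \<Rightarrow> real" where
  "half_smoothed j y m = avg ({..<k} - {j}) (\<lambda>S. P (y - indic S) m)"

lemma smoothed_nonneg: "0 \<le> smoothed y m"
  unfolding cube_average_def by (intro avg_nonneg P_nonneg)

lemma smoothed_sum: "(\<Sum>m\<in>A. smoothed y m) = 1"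
  unfolding cube_average_def by (simp add: P_sum avg_const flip: avg_sum)

lemma fin_supp_amplitude: "fin_supp (amplitude m)"
  unfolding amplitude_def by (intro fin_supp_intros) auto

text \<open>Setting bit \<open>j\<close> of \<open>e\<close> to 1 changes y - e in the same way as
  lowering \<open>y\<close> by a unit vector. This ties a bit of \<open>e\<close>, about which the
  memory knows little, to a unit translation of \<open>y\<close>.\<close>

lemma half_smoothed_insert:
  assumes "j < k"
  shows "avg ({..<k} - {j}) (\<lambda>S. P (y - indic (insert j S)) m) = half_smoothed j (y - unit_at j) m"
  unfolding half_smoothed_def avg_def
proof (intro arg_cong2[where f = "(/)"] sum.cong refl)
  fix S assume "S \<in> Pow ({..<k} - {j})"
  then have "j \<notin> S" by auto
  then have "y - indic (insert j S) = y - unit_at j - indic S"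
    by (auto simp: fun_eq_iff indic_def unit_at_def)
  then show "P (y - indic (insert j S)) m = P (y - unit_at j - indic S) m" by (simp only:)
qed

lemma smoothed_split:
  assumes "j < k"
  shows "smoothed y m = (half_smoothed j y m + half_smoothed j (y - unit_at j) m) / 2"
  using assms avg_split[of "{..<k}" j "\<lambda>S. P (y - indic S) m"]
  by (simp add: half_smoothed_insert cube_average_def flip: half_smoothed_def)

definition local_hellinger :: "nat \<Rightarrow> (nat \<Rightarrow> int) \<Rightarrow> 'm \<Rightarrow> real" where
  "local_hellinger j y m = hellinger (half_smoothed j y m) (half_smoothed j (y - unit_at j) m)"

lemma sum_local_hellinger: "(\<Sum>m\<in>A. \<Sum>j<k. local_hellinger j y m) \<le> 2 * ln K"
proof -
  have "(\<Sum>m\<in>A. \<Sum>j<k. local_hellinger j y m) =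
    (\<Sum>m\<in>A. \<Sum>j<k. hellinger (avg ({..<k} - {j}) (\<lambda>S. P (y - indic S) m))
       (avg ({..<k} - {j}) (\<lambda>S. P (y - indic (insert j S)) m)))"
    by (intro sum.cong refl) (simp add: local_hellinger_def half_smoothed_insert flip: half_smoothed_def)
  also have "\<dots> \<le> 2 * ln K"
    using finA P_nonneg P_sum K by (intro sum_hellinger_le_ln_card) auto
  finally show ?thesis .
qed

definition lower_face :: "nat \<Rightarrow> (nat \<Rightarrow> int) set" where
  "lower_face j = {y \<in> lattice_box k k. y j = 0}"

definition upper_face :: "nat \<Rightarrow> (nat \<Rightarrow> int) set" where
  "upper_face j = {y \<in> lattice_box k k. y j = int k - 1}"

text \<open>By \<open>smoothed_split\<close>, \<open>half_smoothed j x m\<close> is one of the two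
  terms averaged in \<open>smoothed y m\<close> and also in \<open>smoothed x m\<close>, so the
  change of amplitude can pass through its root. The last two terms cover steps across the boundary
  of the box, where one amplitude is 0.\<close>

lemma amplitude_unit_shift:
  fixes y :: "nat \<Rightarrow> int"
  assumes j: "j < k"
  defines "B \<equiv> lattice_box k k" and "x \<equiv> y - unit_at j"
  shows "(amplitude m y - amplitude m x)\<^sup>2 \<le>
     (if y \<in> B then 2 * (sqrt (half_smoothed j x m) - sqrt (smoothed y m))\<^sup>2 else 0)
   + (if x \<in> B then 2 * (sqrt (half_smoothed j x m) - sqrt (smoothed x m))\<^sup>2 else 0)
   + (if y \<in> lower_face j then smoothed y m else 0)
   + (if x \<in> upper_face j then smoothed x m else 0)"
proof -
  have sq: "(a - b)\<^sup>2 \<le> 2 * (c - a)\<^sup>2 + 2 * (c - b)\<^sup>2" for a b c :: real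
    using power2_add_le[of 1 "a - c" "c - b"] by (simp add: power2_commute)
  \<comment> \<open>Only coordinate \<open>j\<close> changes between \<open>x\<close> and
    \<open>y\<close>, so only that one can leave its range.\<close>
  have 1: "y \<in> lower_face j" if yx: "y \<in> B" "x \<notin> B"
  proof -
    obtain i where i: "\<not> ((i < k \<longrightarrow> 0 \<le> x i \<and> x i < k) \<and> (i \<ge> k \<longrightarrow> x i = 0))"
      using yx(2) unfolding B_def lattice_box_iff by blast
    have yi: "\<And>i. (i < k \<longrightarrow> 0 \<le> y i \<and> y i < k) \<and> (i \<ge> k \<longrightarrow> y i = 0)"
      using yx(1) unfolding B_def lattice_box_iff by blast
    have "i = j" using i yi[of i] by (auto simp: x_def unit_at_def split: if_splits)
    then have "y j = 0" using i yi[of j] j by (auto simp: x_def unit_at_def)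
    then show ?thesis using yx(1) by (simp add: lower_face_def B_def)
  qed
  have 2: "x \<in> upper_face j" if yx: "y \<notin> B" "x \<in> B"
  proof -
    obtain i where i: "\<not> ((i < k \<longrightarrow> 0 \<le> y i \<and> y i < k) \<and> (i \<ge> k \<longrightarrow> y i = 0))"
      using yx(1) unfolding B_def lattice_box_iff by blast
    have xi: "\<And>i. (i < k \<longrightarrow> 0 \<le> x i \<and> x i < k) \<and> (i \<ge> k \<longrightarrow> x i = 0)"
      using yx(2) unfolding B_def lattice_box_iff by blast
    have "i = j" using i xi[of i] by (auto simp: x_def unit_at_def split: if_splits)
    then have "x j = int k - 1" using i xi[of j] j by (auto simp: x_def unit_at_def)
    then show ?thesis using yx(2) by (simp add: upper_face_def B_def)
  qed
  have nn: "0 \<le> (if y \<in> lower_face j then smoothed y m else 0)"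
    "0 \<le> (if x \<in> upper_face j then smoothed x m else 0)"
    by (simp_all add: smoothed_nonneg)
  show ?thesis
  proof (cases "y \<in> B"; cases "x \<in> B")
    assume "y \<in> B" "x \<in> B"
    then show ?thesis
      using nn sq[of "sqrt (smoothed y m)" "sqrt (smoothed x m)" "sqrt (half_smoothed j x m)"]
      by (simp add: amplitude_def B_def)
  next
    assume "y \<in> B" "x \<notin> B"
    then show ?thesis
      using 1 nn by (simp add: amplitude_def B_def smoothed_nonneg)
  next
    assume "y \<notin> B" "x \<in> B"
    then show ?thesis
      using 2 nn by (simp add: amplitude_def B_def smoothed_nonneg)
  next
    assume "y \<notin> B" "x \<notin> B"
    then show ?thesis
      using nn by (simp add: amplitude_def B_def)
  qed
qed

lemma shift_dist_amplitude_unit: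
  assumes j: "j < k"
  shows "shift_dist (amplitude m) (unit_at j) \<le>
    2 * (\<Sum>y\<in>lattice_box k k. local_hellinger j y m)
    + (\<Sum>y\<in>lower_face j. smoothed y m) + (\<Sum>y\<in>upper_face j. smoothed y m)"
proof -
  let ?B = "lattice_box k (int k)"
  define F where "F y = (if y \<in> ?B then 2 * (sqrt (half_smoothed j (y - unit_at j) m) - sqrt (smoothed y m))\<^sup>2 else 0)" for y
  define G where "G y = (if y \<in> ?B then 2 * (sqrt (half_smoothed j y m) - sqrt (smoothed y m))\<^sup>2 else 0)" for y
  define L where "L y = (if y \<in> lower_face j then smoothed y m else 0)" for y
  define U where "U y = (if y \<in> upper_face j then smoothed y m else 0)" for y
  have finf: "finite (lower_face j)" "finite (upper_face j)"
    by (auto simp: lower_face_def upper_face_def)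
  have fs: "fin_supp F" "fin_supp G" "fin_supp L" "fin_supp U"
    unfolding F_def G_def L_def U_def using finf by (auto intro!: fin_supp_restrict)
  have fs': "fin_supp (\<lambda>y. G (y - unit_at j))" "fin_supp (\<lambda>y. U (y - unit_at j))"
    using fs by (auto intro: fin_supp_shift)
  have "shift_dist (amplitude m) (unit_at j)
    \<le> infsum (\<lambda>y. F y + G (y - unit_at j) + L y + U (y - unit_at j)) UNIV"
    unfolding shift_dist_def
  proof (intro infsum_mono_fin_supp fin_supp_add fs fs')
    show "fin_supp (\<lambda>y. (amplitude m y - amplitude m (y - unit_at j))\<^sup>2)"
      by (intro fin_supp_intros fin_supp_amplitude)
    show "(amplitude m y - amplitude m (y - unit_at j))\<^sup>2
      \<le> F y + G (y - unit_at j) + L y + U (y - unit_at j)" for y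
      using amplitude_unit_shift[OF j, of m y] by (simp add: F_def G_def L_def U_def)
  qed
  also have "\<dots> = infsum F UNIV + infsum G UNIV + infsum L UNIV + infsum U UNIV"
    by (simp only: infsum_add_fin_supp fin_supp_add fs fs' infsum_shift[of G] infsum_shift[of U])
  also have "infsum L UNIV = (\<Sum>y\<in>lower_face j. smoothed y m)"
    unfolding L_def using finf by (intro infsum_restrict)
  also have "infsum U UNIV = (\<Sum>y\<in>upper_face j. smoothed y m)"
    unfolding U_def using finf by (intro infsum_restrict)
  \<comment> \<open>At each point, \<open>F\<close> and \<open>G\<close> compare the root of the
    midpoint \<open>smoothed y m\<close> with the roots of its two halves, so together they are
    twice a Hellinger term.\<close>
  also have "infsum F UNIV + infsum G UNIV = 2 * (\<Sum>y\<in>?B. local_hellinger j y m)"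
    unfolding F_def G_def local_hellinger_def hellinger_def
    by (simp add: infsum_restrict smoothed_split[OF j] sum_distrib_left flip: sum.distrib)
       (simp add: algebra_simps)
  finally show ?thesis by simp
qed

text \<open>Each of the k^k points of the box costs 2 * 2 ln K by
  \<open>sum_local_hellinger\<close>. The \<open>k\<close> lower faces with k^(k-1) points each have
  total mass k^k, and so do the upper faces.\<close>

lemma sum_shift_dist_amplitude:
  "(\<Sum>m\<in>A. \<Sum>j<k. shift_dist (amplitude m) (unit_at j)) \<le> real k ^ k * (4 * ln K + 2)"
proof -
  let ?B = "lattice_box k (int k)"
  have cl: "card (lower_face j) = k ^ (k - 1)" "card (upper_face j) = k ^ (k - 1)" if "j < k" for j
    using card_lattice_box_face[OF that, of 0 "int k"] card_lattice_box_face[OF that, of "int k - 1" "int k"] k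
    by (simp_all add: lower_face_def upper_face_def)
  have "(\<Sum>m\<in>A. \<Sum>j<k. shift_dist (amplitude m) (unit_at j))
    \<le> (\<Sum>m\<in>A. \<Sum>j<k. 2 * (\<Sum>y\<in>?B. local_hellinger j y m)
    + (\<Sum>y\<in>lower_face j. smoothed y m) + (\<Sum>y\<in>upper_face j. smoothed y m))"
    by (intro sum_mono shift_dist_amplitude_unit) auto
  also have "\<dots> = 2 * (\<Sum>m\<in>A. \<Sum>j<k. \<Sum>y\<in>?B. local_hellinger j y m)
    + (\<Sum>m\<in>A. \<Sum>j<k. \<Sum>y\<in>lower_face j. smoothed y m)
    + (\<Sum>m\<in>A. \<Sum>j<k. \<Sum>y\<in>upper_face j. smoothed y m)"
    by (simp add: sum.distrib sum_distrib_left)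
  also have "(\<Sum>m\<in>A. \<Sum>j<k. \<Sum>y\<in>?B. local_hellinger j y m) = (\<Sum>m\<in>A. \<Sum>y\<in>?B. \<Sum>j<k. local_hellinger j y m)"
    by (intro sum.cong refl sum.swap)
  also have "\<dots> = (\<Sum>y\<in>?B. \<Sum>m\<in>A. \<Sum>j<k. local_hellinger j y m)"
    by (rule sum.swap)
  also have "\<dots> \<le> (\<Sum>y\<in>?B. 2 * ln K)"
    by (intro sum_mono sum_local_hellinger)
  also have "\<dots> = real k ^ k * (2 * ln K)"
    by (simp add: card_lattice_box)
  also have "(\<Sum>m\<in>A. \<Sum>j<k. \<Sum>y\<in>lower_face j. smoothed y m) = (\<Sum>j<k. \<Sum>y\<in>lower_face j. \<Sum>m\<in>A. smoothed y m)"
    by (subst sum.swap) (intro sum.cong refl sum.swap)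
  also have "\<dots> = real k ^ k"
    using k cl by (simp add: smoothed_sum flip: power_Suc)
  also have "(\<Sum>m\<in>A. \<Sum>j<k. \<Sum>y\<in>upper_face j. smoothed y m) = (\<Sum>j<k. \<Sum>y\<in>upper_face j. \<Sum>m\<in>A. smoothed y m)"
    by (subst sum.swap) (intro sum.cong refl sum.swap)
  also have "\<dots> = real k ^ k"
    using k cl by (simp add: smoothed_sum flip: power_Suc)
  finally show ?thesis by (simp add: algebra_simps)
qed

text \<open>Brings the shift into the form needed for \<open>avg_shift_dist_signs\<close> and
  \<open>shift_dist_multiple\<close>: a signed sum of repeated unit vectors.\<close>

lemma signed_shift_eq:
  "signed_shift k z c S = (\<Sum>j<k. if j \<in> S then - (\<Sum>i<z ((j + c) mod k). unit_at j)
      else (\<Sum>i<z ((j + c) mod k). unit_at j))"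
proof
  have app: "(sum f I) x = (\<Sum>i\<in>I. f i x)" if "finite I" for f :: "nat \<Rightarrow> nat \<Rightarrow> int" and I x
    using that by (induction I rule: finite_induct) auto
  fix x
  have "(\<Sum>j<k. if j \<in> S then - (\<Sum>i<z ((j + c) mod k). unit_at j)
      else (\<Sum>i<z ((j + c) mod k). unit_at j)) x
    = (\<Sum>j<k. if j = x then (if j \<in> S then - 1 else 1) * int (z ((j + c) mod k)) else 0)"
    by (subst app, simp, intro sum.cong refl) (auto simp: app unit_at_def simp del: sum_constant intro: sum.neutral, auto)
  also have "\<dots> = signed_shift k z c S x"
    by (simp add: signed_shift_def)
  finally show "signed_shift k z c S x = (\<Sum>j<k. if j \<in> S then - (\<Sum>i<z ((j + c) mod k). unit_at j)
      else (\<Sum>i<z ((j + c) mod k). unit_at j)) x" by simp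
qed

text \<open>The signs decouple the coordinates. Over all cyclic shifts every entry of
  \<open>z\<close> meets every coordinate once, so each unit direction receives the same weight, the
  squared length of \<open>z\<close>.\<close>

lemma average_shift_dist:
  "(\<Sum>c<k. avg {..<k} (\<lambda>S. \<Sum>m\<in>A. shift_dist (amplitude m) (signed_shift k z c S)))
     \<le> (\<Sum>i<k. (real (z i))\<^sup>2) * (real k ^ k * (4 * ln K + 2))"
proof -
  let ?D = "\<lambda>m j. shift_dist (amplitude m) (unit_at j)"
  have "avg {..<k} (\<lambda>S. shift_dist (amplitude m) (signed_shift k z c S))
      \<le> (\<Sum>j<k. (real (z ((j + c) mod k)))\<^sup>2 * ?D m j)" for m c
  proof -
    have "avg {..<k} (\<lambda>S. shift_dist (amplitude m) (signed_shift k z c S))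
      \<le> (\<Sum>j<k. shift_dist (amplitude m) (\<Sum>i<z ((j + c) mod k). unit_at j))"
      unfolding signed_shift_eq by (intro avg_shift_dist_signs fin_supp_amplitude) auto
    also have "\<dots> \<le> (\<Sum>j<k. (real (z ((j + c) mod k)))\<^sup>2 * ?D m j)"
      by (intro sum_mono shift_dist_multiple fin_supp_amplitude)
    finally show ?thesis .
  qed
  then have "(\<Sum>c<k. avg {..<k} (\<lambda>S. \<Sum>m\<in>A. shift_dist (amplitude m) (signed_shift k z c S)))
     \<le> (\<Sum>c<k. \<Sum>m\<in>A. \<Sum>j<k. (real (z ((j + c) mod k)))\<^sup>2 * ?D m j)"
    unfolding avg_sum by (intro sum_mono) auto
  also have "\<dots> = (\<Sum>m\<in>A. \<Sum>c<k. \<Sum>j<k. (real (z ((j + c) mod k)))\<^sup>2 * ?D m j)"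
    by (rule sum.swap)
  also have "\<dots> = (\<Sum>m\<in>A. \<Sum>j<k. \<Sum>c<k. (real (z ((j + c) mod k)))\<^sup>2 * ?D m j)"
    by (intro sum.cong refl sum.swap)
  also have "\<dots> = (\<Sum>m\<in>A. \<Sum>j<k. (\<Sum>i<k. (real (z i))\<^sup>2) * ?D m j)"
    by (simp add: sum_cyclic[of "\<lambda>i. (real (z i))\<^sup>2"] flip: sum_distrib_right)
  also have "\<dots> = (\<Sum>i<k. (real (z i))\<^sup>2) * (\<Sum>m\<in>A. \<Sum>j<k. ?D m j)"
    by (simp add: sum_distrib_left)
  also have "\<dots> \<le> (\<Sum>i<k. (real (z i))\<^sup>2) * (real k ^ k * (4 * ln K + 2))"
    by (intro mult_left_mono sum_shift_dist_amplitude sum_nonneg) auto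
  finally show ?thesis .
qed

text \<open>Substituting y for y + z turns the second sum into the same test weighted by the
  translated squared amplitude. The difference a^2 - b^2 = (a - b)(a + b) is then split by the
  arithmetic-geometric inequality.\<close>

lemma test_difference_le:
  assumes Q: "\<And>y m. 0 \<le> Q y m" "\<And>y m. Q y m \<le> 1"
  shows "(\<Sum>y\<in>lattice_box k k. \<Sum>m\<in>A. smoothed y m * Q y m)
       - (\<Sum>y\<in>lattice_box k k. \<Sum>m\<in>A. smoothed y m * Q (y + z) m)
     \<le> real k ^ k / 2 + 2 * (\<Sum>m\<in>A. shift_dist (amplitude m) z)"
proof -
  let ?B = "lattice_box k (int k)"
  let ?h = amplitude
  have sq: "(?h m y)\<^sup>2 = (if y \<in> ?B then smoothed y m else 0)" for m y
    by (simp add: amplitude_def smoothed_nonneg)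
  have fs: "fin_supp (?h m)" for m by (rule fin_supp_amplitude)
  \<comment> \<open>With the weight 1/8, the terms (a + b)^2 / 8 sum to at most half of the total
    mass k^k. This half has to stay below the gap 98/100 that a correct algorithm achieves.\<close>
  have amgm: "\<bar>u * w\<bar> \<le> 2 * u\<^sup>2 + w\<^sup>2 / 8" for u w :: real
  proof -
    have "0 \<le> (4 * \<bar>u\<bar> - \<bar>w\<bar>)\<^sup>2 / 8" by simp
    then show ?thesis by (simp add: power2_diff power_mult_distrib abs_mult)
  qed
  have *: "(\<Sum>y\<in>?B. smoothed y m * Q y m) - (\<Sum>y\<in>?B. smoothed y m * Q (y + z) m)
    \<le> (\<Sum>y\<in>?B. smoothed y m) / 2 + 2 * shift_dist (?h m) z" for m
  proof -
    let ?F = "\<lambda>y. (?h m y)\<^sup>2 * Q y m"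
    let ?G = "\<lambda>y. (?h m y)\<^sup>2 * Q (y + z) m"
    let ?N = "\<lambda>y. 1 / 4 * (?h m y)\<^sup>2"
    have fsF: "fin_supp ?F" "fin_supp ?G" "fin_supp ?N"
      by (intro fin_supp_intros fs)+
    have fsD: "fin_supp (\<lambda>y. 2 * (?h m y - ?h m (y - z))\<^sup>2)"
      by (intro fin_supp_intros fs)
    have "infsum ?F UNIV \<le> infsum (\<lambda>y. ?G (y - z) + 2 * (?h m y - ?h m (y - z))\<^sup>2 + ?N y + ?N (y - z)) UNIV"
    proof (intro infsum_mono_fin_supp fin_supp_add fsF fsD fin_supp_shift[OF fsF(2)] fin_supp_shift[OF fsF(3)])
      fix y
      define a b q where "a = ?h m y" and "b = ?h m (y - z)" and "q = Q y m"
      have q: "0 \<le> q" "q \<le> 1" using Q by (auto simp: q_def)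
      have "a\<^sup>2 * q - b\<^sup>2 * q = q * ((a - b) * (a + b))"
        by (simp add: power2_eq_square algebra_simps)
      also have "\<dots> \<le> \<bar>q * ((a - b) * (a + b))\<bar>" by simp
      also have "\<dots> \<le> 1 * \<bar>(a - b) * (a + b)\<bar>"
        unfolding abs_mult[of q] using q by (intro mult_right_mono) auto
      also have "\<dots> \<le> 2 * (a - b)\<^sup>2 + (a + b)\<^sup>2 / 8"
        using amgm[of "a - b" "a + b"] by simp
      also have "\<dots> \<le> 2 * (a - b)\<^sup>2 + (2 * a\<^sup>2 + 2 * b\<^sup>2) / 8"
        using power2_add_le[of 1 a b] by simp
      finally have "a\<^sup>2 * q - b\<^sup>2 * q \<le> 2 * (a - b)\<^sup>2 + (2 * a\<^sup>2 + 2 * b\<^sup>2) / 8" .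
      then have "a\<^sup>2 * q \<le> b\<^sup>2 * q + 2 * (a - b)\<^sup>2 + 1 / 4 * a\<^sup>2 + 1 / 4 * b\<^sup>2"
        by argo
      then show "?F y \<le> ?G (y - z) + 2 * (?h m y - ?h m (y - z))\<^sup>2 + ?N y + ?N (y - z)"
        by (simp only: a_def b_def q_def diff_add_cancel)
    qed
    also have "\<dots> = infsum ?G UNIV + 2 * shift_dist (?h m) z + infsum ?N UNIV + infsum ?N UNIV"
      by (simp only: infsum_add_fin_supp fin_supp_add fsF fsD fin_supp_shift[OF fsF(2)]
          fin_supp_shift[OF fsF(3)] infsum_shift[of ?G z] infsum_shift[of ?N z] infsum_cmult shift_dist_def)
    also have "infsum ?N UNIV = (\<Sum>y\<in>?B. smoothed y m) / 4"
      by (simp only: infsum_cmult sq infsum_restrict finite_lattice_box)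
    also have "infsum ?F UNIV = (\<Sum>y\<in>?B. smoothed y m * Q y m)"
      by (simp add: sq if_distrib[of "\<lambda>u. u * _"] infsum_restrict cong: if_cong)
    also have "infsum ?G UNIV = (\<Sum>y\<in>?B. smoothed y m * Q (y + z) m)"
      by (simp add: sq if_distrib[of "\<lambda>u. u * _"] infsum_restrict cong: if_cong)
    finally show ?thesis by simp
  qed
  have "(\<Sum>m\<in>A. (\<Sum>y\<in>?B. smoothed y m * Q y m) - (\<Sum>y\<in>?B. smoothed y m * Q (y + z) m))
    \<le> (\<Sum>m\<in>A. (\<Sum>y\<in>?B. smoothed y m) / 2 + 2 * shift_dist (?h m) z)"
    by (intro sum_mono *)
  also have "\<dots> = (\<Sum>m\<in>A. \<Sum>y\<in>?B. smoothed y m) / 2 + 2 * (\<Sum>m\<in>A. shift_dist (?h m) z)"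
    by (simp add: sum.distrib sum_distrib_left sum_divide_distrib)
  also have "(\<Sum>m\<in>A. \<Sum>y\<in>?B. smoothed y m) = real k ^ k"
    by (subst sum.swap) (simp add: smoothed_sum card_lattice_box)
  finally have *: "(\<Sum>m\<in>A. (\<Sum>y\<in>?B. smoothed y m * Q y m) - (\<Sum>y\<in>?B. smoothed y m * Q (y + z) m))
    \<le> real k ^ k / 2 + 2 * (\<Sum>m\<in>A. shift_dist (?h m) z)" .
  have swap: "(\<Sum>m\<in>A. \<Sum>y\<in>?B. f y m) = (\<Sum>y\<in>?B. \<Sum>m\<in>A. f y m)" for f :: "(nat \<Rightarrow> int) \<Rightarrow> 'm \<Rightarrow> real"
    by (rule sum.swap)
  show ?thesis
    using * by (simp only: sum_subtractf swap[of "\<lambda>y m. smoothed y m * Q y m"]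
        swap[of "\<lambda>y m. smoothed y m * Q (y + z) m"])
qed

text \<open>\<open>Q y m\<close> stands for the probability that a test knowing \<open>y\<close> and
  \<open>m\<close> accepts. A gap above 1/2 bounds 4 ln K + 2 from below by a multiple of
  \<open>k\<close> over the squared length of \<open>z\<close>.\<close>

lemma average_test_difference_le:
  assumes Q: "\<And>y m. 0 \<le> Q y m" "\<And>y m. Q y m \<le> 1"
  shows "(\<Sum>y\<in>lattice_box k k. \<Sum>m\<in>A. smoothed y m * Q y m) / k ^ k
       - (\<Sum>c<k. avg {..<k} (\<lambda>S. \<Sum>y\<in>lattice_box k k. \<Sum>m\<in>A. smoothed y m * Q (y + signed_shift k z c S) m)) / (k * k ^ k)
     \<le> 1 / 2 + 2 * (\<Sum>i<k. (real (z i))\<^sup>2) / k * (4 * ln K + 2)"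
proof -
  let ?a = "\<Sum>y\<in>lattice_box k k. \<Sum>m\<in>A. smoothed y m * Q y m"
  let ?b = "\<lambda>z. \<Sum>y\<in>lattice_box k k. \<Sum>m\<in>A. smoothed y m * Q (y + z) m"
  let ?d = "\<lambda>z. \<Sum>m\<in>A. shift_dist (amplitude m) z"
  have "?a \<le> ?b z + (real k ^ k / 2 + 2 * ?d z)" for z
    using test_difference_le[of Q z] Q by simp
  then have "(\<Sum>c<k. avg {..<k} (\<lambda>S. ?a)) \<le>
    (\<Sum>c<k. avg {..<k} (\<lambda>S. ?b (signed_shift k z c S) + (real k ^ k / 2 + 2 * ?d (signed_shift k z c S))))"
    by (intro sum_mono avg_mono)
  also have "\<dots> = (\<Sum>c<k. avg {..<k} (\<lambda>S. ?b (signed_shift k z c S))) + k * (real k ^ k / 2)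
      + 2 * (\<Sum>c<k. avg {..<k} (\<lambda>S. ?d (signed_shift k z c S)))"
    by (simp only: avg_add avg_cmult avg_const sum.distrib finite_lessThan sum_constant card_lessThan
        flip: sum_distrib_left)
  also have "\<dots> \<le> (\<Sum>c<k. avg {..<k} (\<lambda>S. ?b (signed_shift k z c S))) + k * (real k ^ k / 2)
      + 2 * ((\<Sum>i<k. (real (z i))\<^sup>2) * (real k ^ k * (4 * ln K + 2)))"
    by (intro add_left_mono mult_left_mono average_shift_dist) auto
  finally have "k * ?a - (\<Sum>c<k. avg {..<k} (\<lambda>S. ?b (signed_shift k z c S)))
    \<le> k * (real k ^ k / 2) + 2 * ((\<Sum>i<k. (real (z i))\<^sup>2) * (real k ^ k * (4 * ln K + 2)))"
    by (simp only: avg_const finite_lessThan sum_constant card_lessThan)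
  then have "(k * ?a - (\<Sum>c<k. avg {..<k} (\<lambda>S. ?b (signed_shift k z c S)))) / (k * k ^ k)
    \<le> (k * (real k ^ k / 2) + 2 * ((\<Sum>i<k. (real (z i))\<^sup>2) * (real k ^ k * (4 * ln K + 2)))) / (k * k ^ k)"
    by (intro divide_right_mono) auto
  also have "\<dots> = 1 / 2 + 2 * (\<Sum>i<k. (real (z i))\<^sup>2) / k * (4 * ln K + 2)"
    using k by (simp add: add_divide_distrib)
  also have "(k * ?a - (\<Sum>c<k. avg {..<k} (\<lambda>S. ?b (signed_shift k z c S)))) / (k * k ^ k)
     = ?a / k ^ k - (\<Sum>c<k. avg {..<k} (\<lambda>S. ?b (signed_shift k z c S))) / (k * k ^ k)"
    using k by (simp add: diff_divide_distrib)
  finally show ?thesis by simp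
qed

end

section \<open>Symmetric norms in coordinates\<close>

text \<open>Every function is an admissible argument, which removes the carrier conditions on
  vectors; only the first \<open>n\<close> values matter.\<close>

definition fnorm :: "nat \<Rightarrow> (real Matrix.vec \<Rightarrow> real) \<Rightarrow> (nat \<Rightarrow> real) \<Rightarrow> real" where
  "fnorm n l f = l (Matrix.vec n f)"

lemma vec_eta: "x \<in> carrier_vec n \<Longrightarrow> Matrix.vec n (\<lambda>i. x $ i) = x"
  by auto

lemma fnorm_vec_index: "x \<in> carrier_vec n \<Longrightarrow> fnorm n l (\<lambda>i. x $ i) = l x"
  by (simp add: fnorm_def vec_eta)

lemma fnorm_cong: "(\<And>i. i < n \<Longrightarrow> f i = g i) \<Longrightarrow> fnorm n l f = fnorm n l g"
  unfolding fnorm_def by (intro arg_cong[of _ _ l] eq_vecI) auto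

lemma perm_mat_mult_vec:
  assumes "p permutes {..<n}"
  shows "perm_mat n p *\<^sub>v Matrix.vec n f = Matrix.vec n (\<lambda>i. f (p i))"
proof (rule eq_vecI)
  fix i assume "i < dim_vec (Matrix.vec n (\<lambda>i. f (p i)))"
  then have i: "i < n" by simp
  then have pi: "p i < n" using permutes_in_image[OF assms, of i] by simp
  have "(perm_mat n p *\<^sub>v Matrix.vec n f) $ i = (\<Sum>j<n. (if j = p i then 1 else 0) * f j)"
    using i by (simp add: perm_mat_def scalar_prod_def lessThan_atLeast0)
  also have "\<dots> = f (p i)"
    using pi by (simp add: if_distrib[of "\<lambda>u. u * _"] cong: if_cong)
  finally show "(perm_mat n p *\<^sub>v Matrix.vec n f) $ i = Matrix.vec n (\<lambda>i. f (p i)) $ i"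
    using i by simp
qed (simp add: perm_mat_def)

lemma symmetric_norm_iff:
  "symmetric_norm n l \<longleftrightarrow>
     (\<forall>f. 0 \<le> fnorm n l f) \<and>
     (\<forall>f. fnorm n l f = 0 \<longleftrightarrow> (\<forall>i<n. f i = 0)) \<and>
     (\<forall>f a. fnorm n l (\<lambda>i. a * f i) = \<bar>a\<bar> * fnorm n l f) \<and>
     (\<forall>f g. fnorm n l (\<lambda>i. f i + g i) \<le> fnorm n l f + fnorm n l g) \<and>
     (\<forall>f p. p permutes {..<n} \<longrightarrow> fnorm n l (\<lambda>i. f (p i)) = fnorm n l f) \<and>
     (\<forall>f. fnorm n l (\<lambda>i. \<bar>f i\<bar>) = fnorm n l f)"
proof -
  have ball: "(\<forall>x\<in>carrier_vec n. R x) \<longleftrightarrow> (\<forall>f. R (Matrix.vec n f))" for R :: "real Matrix.vec \<Rightarrow> bool"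
    by (metis vec_carrier vec_eta)
  have 0: "Matrix.vec n f = 0\<^sub>v n \<longleftrightarrow> (\<forall>i<n. f i = 0)" for f :: "nat \<Rightarrow> real"
    by (auto simp: vec_eq_iff)
  have 1: "a \<cdot>\<^sub>v Matrix.vec n f = Matrix.vec n (\<lambda>i. a * f i)" for a and f :: "nat \<Rightarrow> real"
    by auto
  have 2: "Matrix.vec n f + Matrix.vec n g = Matrix.vec n (\<lambda>i. f i + g i)" for f g :: "nat \<Rightarrow> real"
    by auto
  have 3: "map_vec abs (Matrix.vec n f) = Matrix.vec n (\<lambda>i. \<bar>f i\<bar>)" for f :: "nat \<Rightarrow> real"
    by auto
  have perm: "(\<forall>p. p permutes {..<n} \<longrightarrow> (\<forall>f. l (perm_mat n p *\<^sub>v Matrix.vec n f) = l (Matrix.vec n f))) \<longleftrightarrow>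
    (\<forall>f p. p permutes {..<n} \<longrightarrow> l (Matrix.vec n (\<lambda>i. f (p i))) = l (Matrix.vec n f))"
    by (metis (no_types, lifting) perm_mat_mult_vec)
  show ?thesis
    unfolding symmetric_norm_def norm_on_def ball 0 1 2 3 fnorm_def perm by blast
qed

lemma fnorm_restrict_norm:
  "k \<le> n \<Longrightarrow> fnorm k (restrict_norm n l k) f = fnorm n l (\<lambda>i. if i < k then f i else 0)"
  unfolding fnorm_def restrict_norm_def
  by (intro arg_cong[of _ _ l] eq_vecI) auto

context
  fixes n :: nat and l :: "real Matrix.vec \<Rightarrow> real"
  assumes l: "symmetric_norm n l"
begin

lemma fnorm_nonneg: "0 \<le> fnorm n l f"
  and fnorm_eq_0_iff: "fnorm n l f = 0 \<longleftrightarrow> (\<forall>i<n. f i = 0)"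
  and fnorm_scale: "fnorm n l (\<lambda>i. a * f i) = \<bar>a\<bar> * fnorm n l f"
  and fnorm_triangle: "fnorm n l (\<lambda>i. f i + g i) \<le> fnorm n l f + fnorm n l g"
  and fnorm_permute: "p permutes {..<n} \<Longrightarrow> fnorm n l (\<lambda>i. f (p i)) = fnorm n l f"
  and fnorm_abs: "fnorm n l (\<lambda>i. \<bar>f i\<bar>) = fnorm n l f"
  using l unfolding symmetric_norm_iff by blast+

text \<open>Coordinates are replaced one at a time: f m = t * g m with |t| \<le> 1 is a convex
  combination of g m and - g m, and flipping one sign preserves the norm.\<close>

lemma fnorm_mono:
  assumes "\<And>i. i < n \<Longrightarrow> \<bar>f i\<bar> \<le> \<bar>g i\<bar>"
  shows "fnorm n l f \<le> fnorm n l g"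
proof -
  define h where "h m i = (if i < m then f i else g i)" for m i
  have "fnorm n l (h m) \<le> fnorm n l g" if "m \<le> n" for m
    using that
  proof (induction m)
    case 0
    then show ?case by (simp add: h_def)
  next
    case (Suc m)
    \<comment> \<open>If \<open>g m\<close> is 0, then so is \<open>f m\<close>, and division by
      zero gives t = 0, which still satisfies f m = t * g m.\<close>
    define t where "t = f m / g m"
    have le: "\<bar>f m\<bar> \<le> \<bar>g m\<bar>" using assms Suc.prems by simp
    have t: "\<bar>t\<bar> \<le> 1" and ft: "f m = t * g m"
      using le by (auto simp: t_def divide_le_eq_1 abs_divide)
    define h' where "h' i = (if i = m then - h m i else h m i)" for i
    have h': "fnorm n l h' = fnorm n l (h m)"
      by (subst fnorm_abs[symmetric], subst (2) fnorm_abs[symmetric]) (auto simp: h'_def intro!: fnorm_cong)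
    have "fnorm n l (h (Suc m)) = fnorm n l (\<lambda>i. (1 + t) / 2 * h m i + (1 - t) / 2 * h' i)"
      by (intro fnorm_cong) (auto simp: h_def h'_def ft less_Suc_eq field_simps)
    also have "\<dots> \<le> fnorm n l (\<lambda>i. (1 + t) / 2 * h m i) + fnorm n l (\<lambda>i. (1 - t) / 2 * h' i)"
      by (rule fnorm_triangle)
    also have "\<dots> = (1 + t) / 2 * fnorm n l (h m) + (1 - t) / 2 * fnorm n l (h m)"
      using t by (simp only: fnorm_scale h') auto
    also have "\<dots> = fnorm n l (h m)"
      by (simp add: field_simps)
    finally show ?case using Suc by simp
  qed
  from this[of n] have "fnorm n l (h n) \<le> fnorm n l g" by simp
  also have "fnorm n l (h n) = fnorm n l f"
    by (intro fnorm_cong) (simp add: h_def)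
  finally show ?thesis .
qed

lemma fnorm_sign_change:
  assumes "\<And>i. i < n \<Longrightarrow> \<bar>f i\<bar> = \<bar>g i\<bar>"
  shows "fnorm n l f = fnorm n l g"
  using assms by (intro antisym fnorm_mono) auto

lemma fnorm_zero: "fnorm n l (\<lambda>_. 0) = 0"
  by (simp add: fnorm_eq_0_iff)

lemma fnorm_sum_le:
  "finite A \<Longrightarrow> fnorm n l (\<lambda>i. \<Sum>a\<in>A. f a i) \<le> (\<Sum>a\<in>A. fnorm n l (f a))"
proof (induction A rule: finite_induct)
  case (insert a A)
  then show ?case using fnorm_triangle[of "f a" "\<lambda>i. \<Sum>a\<in>A. f a i"] by simp
qed (simp add: fnorm_zero)

lemma fnorm_unit_eq:
  assumes "j < n"
  shows "fnorm n l (\<lambda>i. if i = j then 1 else 0) = fnorm n l (\<lambda>i. if i = 0 then 1 else 0)"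
proof -
  have "Transposition.transpose 0 j permutes {..<n}"
    using assms by (intro permutes_swap_id) auto
  from fnorm_permute[OF this, of "\<lambda>i. if i = j then 1 else 0"]
  have "fnorm n l (\<lambda>i. if i = j then 1 else 0) = fnorm n l (\<lambda>i. if Transposition.transpose 0 j i = j then 1 else 0)"
    by simp
  also have "\<dots> = fnorm n l (\<lambda>i. if i = 0 then 1 else 0)"
    by (intro fnorm_cong) (simp add: Transposition.transpose_def)
  finally show ?thesis .
qed

lemma fnorm_ones_le: "fnorm n l (\<lambda>_. 1) \<le> real n * fnorm n l (\<lambda>i. if i = 0 then 1 else 0)"
proof -
  have "fnorm n l (\<lambda>_. 1) = fnorm n l (\<lambda>i. \<Sum>j<n. if i = j then 1 else 0)"
    by (intro fnorm_cong) simp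
  also have "\<dots> \<le> (\<Sum>j<n. fnorm n l (\<lambda>i. if i = j then 1 else 0))"
    by (intro fnorm_sum_le) auto
  also have "\<dots> = real n * fnorm n l (\<lambda>i. if i = 0 then 1 else 0)"
    using sum.cong[OF refl fnorm_unit_eq, of "{..<n}" "\<lambda>j. j"] by simp
  finally show ?thesis .
qed

lemma fnorm_ones_pos: "n \<ge> 1 \<Longrightarrow> 0 < fnorm n l (\<lambda>_. 1)"
  using fnorm_nonneg[of "\<lambda>_. 1"] fnorm_eq_0_iff[of "\<lambda>_. 1"] by (auto simp: less_le)

text \<open>The constant function with value the l1 distance dominates \<open>f - g\<close>. This
  crude bound supplies all the continuity used below.\<close>

lemma fnorm_lipschitz:
  "\<bar>fnorm n l f - fnorm n l g\<bar> \<le> fnorm n l (\<lambda>_. 1) * (\<Sum>i<n. \<bar>f i - g i\<bar>)"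
proof -
  have *: "fnorm n l f - fnorm n l g \<le> fnorm n l (\<lambda>_. 1) * (\<Sum>i<n. \<bar>f i - g i\<bar>)" for f g
  proof -
    have "fnorm n l f = fnorm n l (\<lambda>i. g i + (f i - g i))" by simp
    also have "\<dots> \<le> fnorm n l g + fnorm n l (\<lambda>i. f i - g i)"
      by (rule fnorm_triangle)
    also have "fnorm n l (\<lambda>i. f i - g i) \<le> fnorm n l (\<lambda>_. (\<Sum>i<n. \<bar>f i - g i\<bar>) * 1)"
    proof (intro fnorm_mono)
      fix i assume "i < n"
      then have "\<bar>f i - g i\<bar> \<le> (\<Sum>i<n. \<bar>f i - g i\<bar>)"
        by (intro member_le_sum) auto
      then show "\<bar>f i - g i\<bar> \<le> \<bar>(\<Sum>i<n. \<bar>f i - g i\<bar>) * 1\<bar>" by simp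
    qed
    also have "\<dots> = fnorm n l (\<lambda>_. 1) * (\<Sum>i<n. \<bar>f i - g i\<bar>)"
      by (subst fnorm_scale) (simp add: abs_of_nonneg sum_nonneg)
    finally show ?thesis by simp
  qed
  show ?thesis
    using *[of f g] *[of g f] by (simp add: abs_le_iff abs_minus_commute)
qed

text \<open>Some permutation moves the smaller complement of \<open>A\<close> into \<open>A\<close>.\<close>

lemma fnorm_ones_le_majority:
  assumes "A \<subseteq> {..<n}" "n \<le> 2 * card A"
  shows "fnorm n l (\<lambda>_. 1) \<le> 2 * fnorm n l (\<lambda>i. if i \<in> A then 1 else 0)"
proof -
  let ?C = "{..<n} - A"
  have fin: "finite A" using assms(1) finite_subset by blast
  have "card ?C \<le> card A"
    using assms fin by (simp add: card_Diff_subset)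
  then obtain B where B: "B \<subseteq> A" "card B = card ?C"
    using obtain_subset_with_card_n by metis
  then obtain f where f: "bij_betw f ?C B"
    using fin finite_same_card_bij[of ?C B] finite_subset[of B A] by auto
  have "card ({..<n} - ?C) = card ({..<n} - B)"
  proof -
    have "B \<subseteq> {..<n}" "finite B" using B(1) assms(1) fin finite_subset by blast+
    then show ?thesis
      by (simp only: card_Diff_subset finite_Diff finite_lessThan Diff_subset B(2))
  qed
  \<comment> \<open>\<open>f\<close> moves the complement of \<open>A\<close> into \<open>A\<close>;
    \<open>g\<close> completes it to a permutation of all indices.\<close>
  then obtain g where g: "bij_betw g ({..<n} - ?C) ({..<n} - B)"
    using finite_same_card_bij[of "{..<n} - ?C" "{..<n} - B"] by auto
  define p where "p i = (if i \<in> ?C then f i else if i < n then g i else i)" for i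
  have "bij_betw p (?C \<union> ({..<n} - ?C)) (B \<union> ({..<n} - B))"
  proof (rule bij_betw_combine)
    show "bij_betw p ?C B"
      using f bij_betw_cong[of ?C p f B] by (simp add: p_def)
    show "bij_betw p ({..<n} - ?C) ({..<n} - B)"
      using g bij_betw_cong[of "{..<n} - ?C" p g "{..<n} - B"] by (simp add: p_def)
  qed auto
  moreover have "?C \<union> ({..<n} - ?C) = {..<n}" "B \<union> ({..<n} - B) = {..<n}"
    using B assms(1) by auto
  ultimately have "p permutes {..<n}"
    by (intro bij_imp_permutes) (auto simp: p_def)
  let ?i = "\<lambda>i. if i \<in> A then 1 else 0 :: real"
  have "fnorm n l (\<lambda>_. 1) \<le> fnorm n l (\<lambda>i. ?i i + ?i (p i))"
  proof (intro fnorm_mono)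
    fix i assume "i < n"
    show "\<bar>1\<bar> \<le> \<bar>?i i + ?i (p i)\<bar>"
    proof (cases "i \<in> A")
      case False
      then have "p i \<in> B" using \<open>i < n\<close> f by (auto simp: p_def bij_betw_def)
      then show ?thesis using B by auto
    qed auto
  qed
  also have "\<dots> \<le> fnorm n l ?i + fnorm n l (\<lambda>i. ?i (p i))"
    by (rule fnorm_triangle)
  also have "fnorm n l (\<lambda>i. ?i (p i)) = fnorm n l ?i"
    by (rule fnorm_permute[OF \<open>p permutes {..<n}\<close>])
  finally show ?thesis by simp
qed

end

lemma symmetric_norm_restrict_norm:
  assumes "symmetric_norm n l" "k \<le> n"
  shows "symmetric_norm k (restrict_norm n l k)"
proof -
  note R = fnorm_restrict_norm[OF assms(2)]
  let ?r = "\<lambda>f i. if i < k then f i else 0 :: real"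
  have perm: "fnorm n l (?r (\<lambda>i. f (p i))) = fnorm n l (?r f)" if "p permutes {..<k}" for f p
  proof -
    have "p permutes {..<n}"
      using that assms(2) by (auto intro: permutes_subset)
    moreover have "?r (\<lambda>i. f (p i)) = (\<lambda>i. ?r f (p i))"
      using permutes_in_image[OF that] by auto
    ultimately show ?thesis using fnorm_permute[OF assms(1), of p "?r f"] by simp
  qed
  have scale: "?r (\<lambda>i. a * f i) = (\<lambda>i. a * ?r f i)" for a f by auto
  have add: "?r (\<lambda>i. f i + g i) = (\<lambda>i. ?r f i + ?r g i)" for f g by auto
  have abs: "?r (\<lambda>i. \<bar>f i\<bar>) = (\<lambda>i. \<bar>?r f i\<bar>)" for f by auto
  show ?thesis
    unfolding symmetric_norm_iff R scale add abs
  proof (intro conjI allI impI)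
    show "fnorm n l (?r f) = 0 \<longleftrightarrow> (\<forall>i<k. f i = 0)" for f
      unfolding fnorm_eq_0_iff[OF assms(1)] using assms(2) by (meson less_le_trans)
  qed (rule perm fnorm_nonneg[OF assms(1)] fnorm_scale[OF assms(1)] fnorm_abs[OF assms(1)]
      fnorm_triangle[OF assms(1)] | assumption)+
qed

section \<open>The median on the sphere\<close>

text \<open>Change of variables for a diagonal matrix. A product measure is determined by its values
  on boxes, where the claim splits into one-dimensional scalings.\<close>

lemma PiM_lborel_scaling:
  fixes c :: "nat \<Rightarrow> real"
  assumes c: "\<And>i. i < k \<Longrightarrow> 0 < c i" and B: "B \<in> sets (\<Pi>\<^sub>M i\<in>{..<k}. lborel)"
  defines "T \<equiv> \<lambda>x. \<lambda>i\<in>{..<k}. c i * x i"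
  shows "emeasure (\<Pi>\<^sub>M i\<in>{..<k}. lborel) B
    = ennreal (\<Prod>i<k. c i) * emeasure (\<Pi>\<^sub>M i\<in>{..<k}. lborel) (T -` B \<inter> space (\<Pi>\<^sub>M i\<in>{..<k}. lborel))"
proof -
  interpret product_sigma_finite "\<lambda>_::nat. lborel :: real measure" by standard
  let ?M = "\<Pi>\<^sub>M i\<in>{..<k}. (lborel :: real measure)"
  have T [measurable]: "T \<in> measurable ?M ?M"
    unfolding T_def by measurable
  have "scale_measure (ennreal (\<Prod>i<k. c i)) (distr ?M ?M T) = ?M"
  proof (rule PiM_eqI)
    fix A assume A: "\<And>i. i \<in> {..<k} \<Longrightarrow> A i \<in> sets (lborel :: real measure)"
    have vim: "T -` (Pi\<^sub>E {..<k} A) \<inter> space ?M = Pi\<^sub>E {..<k} (\<lambda>i. (*) (c i) -` A i)"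
      by (auto simp: T_def space_PiM PiE_def Pi_def extensional_def)
    have m: "(*) (c i) -` A i \<in> sets (lborel :: real measure)" if "i \<in> {..<k}" for i
      using measurable_sets[of "(*) (c i)" lborel lborel "A i"] A[OF that] by simp
    have one: "emeasure lborel (A i) = ennreal (c i) * emeasure lborel ((*) (c i) -` A i)" if "i \<in> {..<k}" for i
    proof -
      have "emeasure lborel (A i) = emeasure (density (distr lborel borel ((*) (c i))) (\<lambda>_. ennreal \<bar>c i\<bar>)) (A i)"
        using c[of i] that by (subst lborel_distr_mult'[of "c i"]) auto
      also have "\<dots> = ennreal (c i) * emeasure lborel ((*) (c i) -` A i)"
        using c[of i] that A[OF that] by (simp add: emeasure_density nn_integral_cmult emeasure_distr)
      finally show ?thesis .
    qed
    have "emeasure (scale_measure (ennreal (\<Prod>i<k. c i)) (distr ?M ?M T)) (Pi\<^sub>E {..<k} A)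
      = ennreal (\<Prod>i<k. c i) * emeasure ?M (Pi\<^sub>E {..<k} (\<lambda>i. (*) (c i) -` A i))"
      using A by (simp add: emeasure_distr vim sets_PiM_I_finite)
    also have "\<dots> = (\<Prod>i<k. ennreal (c i)) * (\<Prod>i<k. emeasure lborel ((*) (c i) -` A i))"
    proof -
      have "ennreal (\<Prod>i<k. c i) = (\<Prod>i<k. ennreal (c i))"
        using c by (intro prod_ennreal[symmetric]) (auto intro: less_imp_le)
      then show ?thesis using m by (subst emeasure_PiM) auto
    qed
    also have "\<dots> = (\<Prod>i<k. emeasure lborel (A i))"
      by (simp add: one flip: prod.distrib)
    finally show "emeasure (scale_measure (ennreal (\<Prod>i<k. c i)) (distr ?M ?M T)) (Pi\<^sub>E {..<k} A)
      = (\<Prod>i\<in>{..<k}. emeasure lborel (A i))" .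
  qed auto
  then have "emeasure ?M B = emeasure (scale_measure (ennreal (\<Prod>i<k. c i)) (distr ?M ?M T)) B"
    by simp
  also have "\<dots> = ennreal (\<Prod>i<k. c i) * emeasure ?M (T -` B \<inter> space ?M)"
    using B by (simp add: emeasure_distr)
  finally show ?thesis .
qed

text \<open>The infimum of the points where the distribution function reaches 1/2: right continuity
  gives one inequality, the left limit the other.\<close>

lemma (in real_distribution) median_exists:
  "\<exists>m. 1 / 2 \<le> measure M {m..} \<and> 1 / 2 \<le> measure M {..m}"
proof -
  let ?T = "{t. 1 / 2 \<le> cdf M t}"
  have "eventually (\<lambda>t. cdf M t > 1 / 2) at_top"
    using order_tendstoD(1)[OF cdf_lim_at_top_prob, of "1 / 2"] by simp
  then obtain t0 where t0: "cdf M t0 > 1 / 2"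
    by (meson eventually_at_top_linorder order_refl)
  then have ne: "?T \<noteq> {}" by (auto intro: less_imp_le)
  have "eventually (\<lambda>t. cdf M t < 1 / 2) at_bot"
    using order_tendstoD(2)[OF cdf_lim_at_bot, of "1 / 2"] by simp
  then obtain t1 where t1: "cdf M t < 1 / 2" if "t \<le> t1" for t
    by (meson eventually_at_bot_linorder)
  then have bdd: "bdd_below ?T"
    by (intro bdd_belowI[of _ t1]) (metis linorder_le_cases linorder_not_le mem_Collect_eq)
  define m where "m = Inf ?T"
  have above: "1 / 2 \<le> cdf M t" if mt: "m < t" for t
  proof -
    obtain t' where "t' \<in> ?T" "t' < t"
      using mt cInf_less_iff[OF ne bdd, of t] unfolding m_def by blast
    then show ?thesis using cdf_nondecreasing[of t' t] by simp
  qed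
  have below: "cdf M t < 1 / 2" if "t < m" for t
    using that cInf_lower[OF _ bdd, of t] by (force simp: m_def)
  have "(cdf M \<longlongrightarrow> cdf M m) (at_right m)"
    using cdf_is_right_cont[of m] by (simp add: continuous_within)
  then have 1: "1 / 2 \<le> cdf M m"
    by (rule tendsto_lowerbound)
       (use above in \<open>auto intro!: eventually_at_rightI[of m "m + 1"]\<close>)
  have "measure M {..<m} \<le> 1 / 2"
    using cdf_at_left[of m]
    by (rule tendsto_upperbound)
       (use below in \<open>auto intro!: eventually_at_leftI[of "m - 1" m] less_imp_le\<close>)
  moreover have "measure M {m..} = 1 - measure M {..<m}"
    using prob_compl[of "{..<m}"] by (simp add: Compl_eq_Diff_UNIV[symmetric] Compl_lessThan)
  ultimately show ?thesis using 1 by (intro exI[of _ m]) (auto simp: cdf_def)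
qed

section \<open>The law of the norm on the sphere, as a distribution on the real line\<close>

context
  fixes k :: nat and l :: "real Matrix.vec \<Rightarrow> real"
  assumes l: "symmetric_norm k l" and k: "k \<ge> 1"
begin

abbreviation leb :: "(nat \<Rightarrow> real) measure" where
  "leb \<equiv> \<Pi>\<^sub>M i\<in>{..<k}. lborel"

definition unit_ball :: "(nat \<Rightarrow> real) set" where
  "unit_ball = {x \<in> space leb. L2_set x {..<k} \<le> 1}"

text \<open>Homogeneous of degree 0: its value at a nonzero point is the norm of the projection to
  the sphere, so probabilities on the sphere become volumes in the ball.\<close>

definition radial :: "(nat \<Rightarrow> real) \<Rightarrow> real" where
  "radial x = fnorm k l x / L2_set x {..<k}"

definition radial_law :: "real measure" where
  "radial_law = distr (uniform_measure leb unit_ball) borel radial"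

lemma fnorm_measurable: "fnorm k l \<in> borel_measurable (\<Pi>\<^sub>M i\<in>{..<k}. borel)"
proof -
  have "continuous_on UNIV (fnorm k l)"
  proof (unfold continuous_on_def, intro ballI)
    fix x :: "nat \<Rightarrow> real"
    have coord: "((\<lambda>y. y i) \<longlongrightarrow> x i) (at x)" for i
      using continuous_on_product_coordinates[of i] by (auto simp: continuous_on_def)
    have "((\<lambda>y. fnorm k l (\<lambda>_. 1) * (\<Sum>i<k. \<bar>y i - x i\<bar>)) \<longlongrightarrow> fnorm k l (\<lambda>_. 1) * (\<Sum>i<k. \<bar>x i - x i\<bar>)) (at x)"
      by (intro tendsto_intros coord)
    then have "((\<lambda>y. fnorm k l (\<lambda>_. 1) * (\<Sum>i<k. \<bar>y i - x i\<bar>)) \<longlongrightarrow> 0) (at x)"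
      by simp
    then have "((\<lambda>y. fnorm k l y - fnorm k l x) \<longlongrightarrow> 0) (at x)"
      by (rule Lim_null_comparison[rotated]) (simp add: fnorm_lipschitz[OF l])
    then show "(fnorm k l \<longlongrightarrow> fnorm k l x) (at x)"
      by (rule Lim_null[THEN iffD2])
  qed
  then have 1: "fnorm k l \<in> borel_measurable (\<Pi>\<^sub>M i\<in>UNIV. borel)"
    using borel_measurable_continuous_onI[of "fnorm k l"] measurable_cong_sets[OF sets_PiM_equal_borel refl] by blast
  \<comment> \<open>Points of the finite product are \<open>undefined\<close> from \<open>k\<close>
    on. Padding by 0 moves them measurably into the full product, where continuity applies, and
    \<open>fnorm\<close> does not see the change.\<close>
  have 2: "(\<lambda>x i. if i < k then x i else 0) \<in> measurable (\<Pi>\<^sub>M i\<in>{..<k}. borel :: real measure) (\<Pi>\<^sub>M i\<in>UNIV. borel)"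
  proof (rule measurable_PiM_single')
    show "(\<lambda>x. if i < k then x i else 0) \<in> measurable (\<Pi>\<^sub>M i\<in>{..<k}. borel :: real measure) borel" for i
      by (cases "i < k") auto
  qed auto
  have "(\<lambda>x. fnorm k l (\<lambda>i. if i < k then x i else 0)) \<in> borel_measurable (\<Pi>\<^sub>M i\<in>{..<k}. borel)"
    using measurable_compose[OF 2 1] by simp
  moreover have "fnorm k l (\<lambda>i. if i < k then x i else 0) = fnorm k l x" for x
    by (intro fnorm_cong) simp
  ultimately show ?thesis by simp
qed

lemma sets_leb: "sets leb = sets (\<Pi>\<^sub>M i\<in>{..<k}. borel)"
  by (intro sets_PiM_cong) auto

lemma fnorm_measurable_leb [measurable]: "fnorm k l \<in> borel_measurable leb"
  using fnorm_measurable measurable_cong_sets[OF sets_leb refl] by blast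

lemma L2_set_measurable [measurable]: "(\<lambda>x. L2_set x {..<k}) \<in> borel_measurable leb"
  unfolding L2_set_def by measurable

lemma radial_measurable [measurable]: "radial \<in> borel_measurable leb"
  unfolding radial_def by measurable

lemma unit_ball_sets [measurable]: "unit_ball \<in> sets leb"
  unfolding unit_ball_def by measurable

lemma radial_scale: "c > 0 \<Longrightarrow> radial (\<lambda>i. c * x i) = radial x"
  by (simp add: radial_def fnorm_scale[OF l] L2_set_right_distrib[symmetric])

lemma L2_set_lipschitz: "\<bar>L2_set x {..<k} - L2_set y {..<k}\<bar> \<le> (\<Sum>i<k. \<bar>x i - y i\<bar>)"
proof -
  have *: "L2_set x {..<k} \<le> L2_set y {..<k} + (\<Sum>i<k. \<bar>x i - y i\<bar>)" for x y
  proof -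
    have "L2_set x {..<k} = L2_set (\<lambda>i. y i + (x i - y i)) {..<k}" by simp
    also have "\<dots> \<le> L2_set y {..<k} + L2_set (\<lambda>i. x i - y i) {..<k}"
      by (rule L2_set_triangle_ineq)
    also have "L2_set (\<lambda>i. x i - y i) {..<k} \<le> (\<Sum>i<k. \<bar>x i - y i\<bar>)"
      by (rule L2_set_le_sum_abs)
    finally show ?thesis by simp
  qed
  show ?thesis using *[of x y] *[of y x] by (simp add: abs_le_iff abs_minus_commute)
qed

lemma emeasure_cube:
  assumes "\<And>i. i < k \<Longrightarrow> a i \<le> b i"
  shows "emeasure leb (\<Pi>\<^sub>E i\<in>{..<k}. {a i<..<b i}) = ennreal (\<Prod>i<k. b i - a i)"
proof -
  interpret product_sigma_finite "\<lambda>_::nat. lborel :: real measure" by standard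
  show ?thesis
    using assms by (subst emeasure_PiM) (auto intro!: prod_ennreal)
qed

lemma unit_ball_finite: "emeasure leb unit_ball < \<infinity>"
proof -
  have "unit_ball \<subseteq> (\<Pi>\<^sub>E i\<in>{..<k}. {-2<..<2})"
  proof
    fix x assume x: "x \<in> unit_ball"
    have "-2 < x i \<and> x i < 2" if "i < k" for i
    proof -
      have "\<bar>x i\<bar> \<le> L2_set (\<lambda>i. \<bar>x i\<bar>) {..<k}"
        using that by (intro member_le_L2_set) auto
      also have "\<dots> \<le> 1" using x by (simp add: unit_ball_def L2_set_def)
      finally show ?thesis by linarith
    qed
    then show "x \<in> (\<Pi>\<^sub>E i\<in>{..<k}. {-2<..<2})"
      using x by (auto simp: unit_ball_def space_PiM PiE_def)
  qed
  then have "emeasure leb unit_ball \<le> emeasure leb (\<Pi>\<^sub>E i\<in>{..<k}. {-2<..<2})"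
    by (intro emeasure_mono sets_PiM_I_finite) auto
  also have "\<dots> < \<infinity>" by (subst emeasure_cube) auto
  finally show ?thesis .
qed

lemma emeasure_pos_of_cube:
  assumes "A \<in> sets leb" "d > 0"
    and "\<And>x. x \<in> space leb \<Longrightarrow> (\<And>i. i < k \<Longrightarrow> \<bar>x i - u i\<bar> < d) \<Longrightarrow> x \<in> A"
  shows "emeasure leb A > 0"
proof -
  have "0 < ennreal (\<Prod>i<k. (u i + d) - (u i - d))"
    using assms(2) by (auto intro!: prod_pos)
  also have "\<dots> = emeasure leb (\<Pi>\<^sub>E i\<in>{..<k}. {u i - d<..<u i + d})"
    using assms(2) by (subst emeasure_cube) auto
  also have "\<dots> \<le> emeasure leb A"
  proof (rule emeasure_mono[OF subsetI assms(1)])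
    fix x assume x: "x \<in> (\<Pi>\<^sub>E i\<in>{..<k}. {u i - d<..<u i + d})"
    show "x \<in> A"
    proof (rule assms(3))
      show "x \<in> space leb" using x by (auto simp: space_PiM PiE_def)
      show "\<bar>x i - u i\<bar> < d" if "i < k" for i
        using x that by (auto simp: PiE_def Pi_def abs_less_iff algebra_simps)
    qed
  qed
  finally show ?thesis .
qed

lemma unit_ball_pos: "emeasure leb unit_ball > 0"
proof (rule emeasure_pos_of_cube[where u = "\<lambda>_. 0" and d = "1 / real k"])
  fix x assume x: "x \<in> space leb" "\<And>i. i < k \<Longrightarrow> \<bar>x i - 0\<bar> < 1 / real k"
  have "L2_set x {..<k} \<le> (\<Sum>i<k. \<bar>x i\<bar>)" by (rule L2_set_le_sum_abs)
  also have "\<dots> \<le> (\<Sum>i<k. 1 / real k)"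
    using x by (intro sum_mono) (auto intro: less_imp_le)
  also have "\<dots> = 1" using k by simp
  finally show "x \<in> unit_ball" using x by (simp add: unit_ball_def)
qed (use k in auto)

lemma prob_space_ball: "prob_space (uniform_measure leb unit_ball)"
  using unit_ball_pos unit_ball_finite by (intro prob_space_uniform_measure) auto

lemma real_distribution_radial_law: "real_distribution radial_law"
proof -
  interpret prob_space "uniform_measure leb unit_ball" by (rule prob_space_ball)
  show ?thesis
    unfolding radial_law_def by (intro real_distribution_distr) simp
qed

lemma measure_radial_law:
  assumes "I \<in> sets borel"
  shows "measure radial_law I = measure leb (unit_ball \<inter> radial -` I) / measure leb unit_ball"
proof -
  have m: "radial -` I \<inter> space leb \<in> sets leb"
    using assms by measurable
  have "measure radial_law I = measure (uniform_measure leb unit_ball) (radial -` I \<inter> space leb)"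
    unfolding radial_law_def using assms by (subst measure_distr) auto
  also have "\<dots> = measure leb (unit_ball \<inter> (radial -` I \<inter> space leb)) / measure leb unit_ball"
    using unit_ball_pos unit_ball_finite m by (intro measure_uniform_measure) auto
  also have "unit_ball \<inter> (radial -` I \<inter> space leb) = unit_ball \<inter> radial -` I"
    by (auto simp: unit_ball_def)
  finally show ?thesis .
qed

lemma prob_uniform_sphere:
  assumes I: "I \<in> sets borel"
  shows "\<P>(x in uniform_sphere k. l x \<in> I) = measure radial_law I"
proof -
  let ?N = "\<lambda>x. Matrix.vec k (\<lambda>i. x i / L2_set x {..<k})"
  let ?\<phi> = "\<lambda>x. \<lambda>i\<in>{..<k}. x $ i"
  have us: "uniform_sphere k = distr (uniform_measure leb unit_ball) (vec_borel k) ?N"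
    by (simp add: uniform_sphere_def unit_ball_def L2_set_def)
  have sp: "space (vec_borel k) = carrier_vec k"
    by (simp add: vec_borel_def)
  have N: "?N \<in> measurable leb (vec_borel k)"
    unfolding vec_borel_def
  proof (rule measurable_vimage_algebra2)
    have "(\<lambda>x. \<lambda>i\<in>{..<k}. ?N x $ i) = (\<lambda>x. \<lambda>i\<in>{..<k}. x i / L2_set x {..<k})"
      by (auto simp: fun_eq_iff)
    moreover have "(\<lambda>x. \<lambda>i\<in>{..<k}. x i / L2_set x {..<k}) \<in> measurable leb (\<Pi>\<^sub>M i\<in>{..<k}. borel)"
      by measurable
    ultimately show "(\<lambda>x. \<lambda>i\<in>{..<k}. ?N x $ i) \<in> measurable leb (\<Pi>\<^sub>M i\<in>{..<k}. borel)" by simp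
  qed auto
  have "?\<phi> \<in> measurable (vec_borel k) (\<Pi>\<^sub>M i\<in>{..<k}. borel)"
    unfolding vec_borel_def by (rule measurable_vimage_algebra1) (auto simp: space_PiM)
  from measurable_compose[OF this fnorm_measurable]
  have "(\<lambda>x. fnorm k l (?\<phi> x)) \<in> borel_measurable (vec_borel k)" .
  moreover have "fnorm k l (?\<phi> x) = l x" if "x \<in> space (vec_borel k)" for x
    using that by (subst fnorm_vec_index[symmetric]) (auto simp: sp intro!: fnorm_cong)
  ultimately have lm: "l \<in> borel_measurable (vec_borel k)"
    by (subst measurable_cong[of _ _ "\<lambda>x. fnorm k l (?\<phi> x)"]) auto
  \<comment> \<open>At points of length 0 both sides are 0, by division by zero.\<close>
  have lN: "l (?N x) = radial x" for x
    using fnorm_scale[OF l, of "1 / L2_set x {..<k}" x] by (simp add: radial_def fnorm_def)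
  have "distr (uniform_sphere k) borel l = radial_law"
    unfolding us radial_law_def using N lm
    by (subst distr_distr) (auto intro!: distr_cong simp: lN)
  then have "measure radial_law I = measure (distr (uniform_sphere k) borel l) I" by simp
  also have "\<dots> = measure (uniform_sphere k) (l -` I \<inter> space (uniform_sphere k))"
    using lm I by (intro measure_distr) (auto simp: us)
  also have "l -` I \<inter> space (uniform_sphere k) = {x \<in> space (uniform_sphere k). l x \<in> I}"
    by auto
  finally show ?thesis by simp
qed

lemma is_median_iff:
  "is_median_on_sphere k l m \<longleftrightarrow> 1 / 2 \<le> measure radial_law {m..} \<and> 1 / 2 \<le> measure radial_law {..m}"
  using prob_uniform_sphere[of "{m..}"] prob_uniform_sphere[of "{..m}"]
  by (simp add: is_median_on_sphere_def)


section \<open>Uniqueness of the median\<close>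

lemma measure_leb_ball_pos: "measure leb unit_ball > 0"
  using unit_ball_pos unit_ball_finite by (simp add: measure_def enn2real_positive_iff)

lemma radial_law_pos:
  assumes "I \<in> sets borel" "emeasure leb (unit_ball \<inter> radial -` I) > 0"
  shows "measure radial_law I > 0"
proof -
  have "emeasure leb (unit_ball \<inter> radial -` I) \<le> emeasure leb unit_ball"
    by (intro emeasure_mono) auto
  then have "measure leb (unit_ball \<inter> radial -` I) > 0"
    using assms(2) unit_ball_finite by (simp add: measure_def enn2real_positive_iff)
  then show ?thesis
    using measure_leb_ball_pos by (simp add: measure_radial_law[OF assms(1)])
qed

text \<open>The origin is a null set because k \<ge> 1, so a set of positive measure has another
  point.\<close>

lemma exists_nonzero_of_radial_law_pos:
  assumes "I \<in> sets borel" "measure radial_law I > 0"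
  obtains x where "L2_set x {..<k} > 0" "radial x \<in> I"
proof -
  interpret product_sigma_finite "\<lambda>_::nat. lborel :: real measure" by standard
  let ?o = "\<lambda>i\<in>{..<k}. 0 :: real"
  have "(0 :: ennreal) ^ k = 0" using k by (intro zero_power) auto
  have "{?o} = (\<Pi>\<^sub>E i\<in>{..<k}. {0})"
    by (auto simp: PiE_def extensional_def fun_eq_iff)
  then have os: "{?o} \<in> sets leb"
    by (simp only:) (rule sets_PiM_I_finite, auto)
  have "emeasure leb (\<Pi>\<^sub>E i\<in>{..<k}. {0}) = (\<Prod>i<k. emeasure lborel {0 :: real})"
    by (rule emeasure_PiM) auto
  then have o: "emeasure leb {?o} = 0"
    using \<open>0 ^ k = 0\<close> by (simp only: \<open>{?o} = _\<close> emeasure_lborel_singleton prod_constant card_lessThan)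
  have "\<not> unit_ball \<inter> radial -` I \<subseteq> {?o}"
  proof
    assume "unit_ball \<inter> radial -` I \<subseteq> {?o}"
    then have "emeasure leb (unit_ball \<inter> radial -` I) \<le> emeasure leb {?o}"
      using os by (rule emeasure_mono)
    then have "measure leb (unit_ball \<inter> radial -` I) = 0"
      using o by (simp add: measure_def)
    then show False
      using assms by (simp add: measure_radial_law)
  qed
  then obtain x where x: "x \<in> unit_ball" "radial x \<in> I" "x \<noteq> ?o" by auto
  then obtain i where i: "x i \<noteq> ?o i" by blast
  moreover have "x i = undefined" if "\<not> i < k"
    using x(1) that by (auto simp: unit_ball_def space_PiM PiE_def extensional_def)
  ultimately have "i < k" "x i \<noteq> 0" by (auto split: if_splits)
  then have "L2_set x {..<k} \<noteq> 0"
    by (auto simp: L2_set_eq_0_iff)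
  then have "L2_set x {..<k} > 0"
    using L2_set_nonneg[of x "{..<k}"] by linarith
  then show ?thesis using x that by blast
qed

text \<open>Intermediate value theorem on the segment from \<open>x\<close> to \<open>y\<close>. The
  segment avoids the origin: otherwise \<open>x\<close> and \<open>y\<close> would be negative
  multiples of each other, and \<open>radial\<close> would agree on them.\<close>

lemma radial_intermediate_value:
  assumes x: "L2_set x {..<k} > 0" "radial x < a" and y: "L2_set y {..<k} > 0" "a < radial y"
  obtains u where "L2_set u {..<k} > 0" "radial u = a"
proof -
  define w where "w t i = (1 - t) * x i + t * y i" for t i
  have w: "L2_set (w t) {..<k} > 0" if "0 \<le> t" "t \<le> 1" for t
  proof (rule ccontr)
    assume "\<not> L2_set (w t) {..<k} > 0"
    then have "L2_set (w t) {..<k} = 0"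
      using L2_set_nonneg[of "w t" "{..<k}"] by linarith
    then have z: "(1 - t) * x i = - t * y i" if "i < k" for i
    proof -
      have "w t i = 0" using \<open>L2_set (w t) {..<k} = 0\<close> that by (simp add: L2_set_eq_0_iff)
      then show ?thesis by (simp add: w_def algebra_simps)
    qed
    have "t \<noteq> 1"
    proof
      assume "t = 1"
      then have "L2_set y {..<k} = 0" using z by (auto simp: L2_set_eq_0_iff)
      then show False using y by simp
    qed
    have "t \<noteq> 0"
    proof
      assume "t = 0"
      then have "L2_set x {..<k} = 0" using z by (auto simp: L2_set_eq_0_iff)
      then show False using x by simp
    qed
    have t: "0 < t" "0 < 1 - t" using \<open>t \<noteq> 0\<close> \<open>t \<noteq> 1\<close> that by auto
    have abs: "\<bar>(1 - t) * x i\<bar> = \<bar>t * y i\<bar>" if "i < k" for i using z[OF that] by simp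
    have "radial x = radial (\<lambda>i. (1 - t) * x i)"
      by (rule radial_scale[symmetric]) (use t in auto)
    also have "\<dots> = radial (\<lambda>i. t * y i)"
    proof -
      have "fnorm k l (\<lambda>i. (1 - t) * x i) = fnorm k l (\<lambda>i. t * y i)"
        by (rule fnorm_sign_change[OF l]) (rule abs)
      moreover have "L2_set (\<lambda>i. (1 - t) * x i) {..<k} = L2_set (\<lambda>i. t * y i) {..<k}"
        unfolding L2_set_def using abs by (intro arg_cong[of _ _ sqrt] sum.cong) (auto simp: abs_eq_iff power2_eq_iff)
      ultimately show ?thesis by (simp add: radial_def)
    qed
    also have "\<dots> = radial y"
      by (rule radial_scale) (use t in auto)
    finally show False using x y by simp
  qed
  have L2c: "continuous_on {0..1} (\<lambda>t. L2_set (w t) {..<k})"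
    unfolding L2_set_def w_def by (intro continuous_intros)
  have "continuous_on {0..1} (\<lambda>t. fnorm k l (w t))"
  proof (unfold continuous_on_def, intro ballI)
    fix t :: real
    have "((\<lambda>s. fnorm k l (\<lambda>_. 1) * (\<Sum>i<k. \<bar>w s i - w t i\<bar>)) \<longlongrightarrow>
        fnorm k l (\<lambda>_. 1) * (\<Sum>i<k. \<bar>w t i - w t i\<bar>)) (at t within {0..1})"
      unfolding w_def by (intro tendsto_intros)
    then have "((\<lambda>s. fnorm k l (\<lambda>_. 1) * (\<Sum>i<k. \<bar>w s i - w t i\<bar>)) \<longlongrightarrow> 0) (at t within {0..1})"
      by simp
    then have "((\<lambda>s. fnorm k l (w s) - fnorm k l (w t)) \<longlongrightarrow> 0) (at t within {0..1})"
      by (rule Lim_null_comparison[rotated]) (simp add: fnorm_lipschitz[OF l])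
    then show "((\<lambda>s. fnorm k l (w s)) \<longlongrightarrow> fnorm k l (w t)) (at t within {0..1})"
      by (rule Lim_null[THEN iffD2])
  qed
  then have "continuous_on {0..1} (\<lambda>t. radial (w t))"
    unfolding radial_def using w by (intro continuous_on_divide L2c) force+
  moreover have "radial (w 0) \<le> a" "a \<le> radial (w 1)"
  proof -
    have "w 0 = x" "w 1 = y" by (auto simp: w_def)
    then show "radial (w 0) \<le> a" "a \<le> radial (w 1)" using x y by simp_all
  qed
  ultimately obtain t where "0 \<le> t" "t \<le> 1" "radial (w t) = a"
    using IVT'[of "\<lambda>t. radial (w t)" 0 a 1] by auto
  then show ?thesis using w that by blast
qed

text \<open>Rescale \<open>u\<close> to length 1/2, inside the ball. Both strict inequalities then
  persist on a small cube, since the norm and the length are Lipschitz.\<close>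

lemma radial_law_gap_pos:
  assumes u: "L2_set u {..<k} > 0" "m < radial u" "radial u < m'"
  shows "measure radial_law {m<..<m'} > 0"
proof (rule radial_law_pos)
  define v where "v i = 1 / (2 * L2_set u {..<k}) * u i" for i
  have v: "L2_set v {..<k} = 1 / 2" "radial v = radial u"
  proof -
    have "L2_set v {..<k} = 1 / (2 * L2_set u {..<k}) * L2_set u {..<k}"
      unfolding v_def using u by (intro L2_set_right_distrib[symmetric]) auto
    then show "L2_set v {..<k} = 1 / 2" using u by simp
    show "radial v = radial u" unfolding v_def using u by (intro radial_scale) auto
  qed
  let ?N = "fnorm k l" and ?R = "\<lambda>x. L2_set x {..<k}"
  have Nv: "m * ?R v < ?N v" "?N v < m' * ?R v"
    using u v by (simp_all add: radial_def[of v] field_simps)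
  define C where "C = ?N (\<lambda>_. 1) + \<bar>m\<bar> + \<bar>m'\<bar> + 1"
  have C: "C > 0" using fnorm_nonneg[OF l, of "\<lambda>_. 1"] by (auto simp: C_def)
  \<comment> \<open>The bound 1/4 keeps the length of a point near \<open>v\<close> between 1/4 and
    3/4; the other two bounds are the slack in \<open>Nv\<close>.\<close>
  define e where "e = min (1 / 4) (min (?N v - m * ?R v) (m' * ?R v - ?N v))"
  have e: "e > 0" using Nv by (auto simp: e_def)
  have C1: "1 \<le> C" using fnorm_nonneg[OF l, of "\<lambda>_. 1"] by (simp add: C_def)
  show "emeasure leb (unit_ball \<inter> radial -` {m<..<m'}) > 0"
  proof (rule emeasure_pos_of_cube[where u = v and d = "e / (C * real k)"])
    have "radial -` {m<..<m'} \<inter> space leb \<in> sets leb" by measurable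
    moreover have "unit_ball \<inter> (radial -` {m<..<m'} \<inter> space leb) = unit_ball \<inter> radial -` {m<..<m'}"
      by (auto simp: unit_ball_def)
    ultimately show "unit_ball \<inter> radial -` {m<..<m'} \<in> sets leb"
      using unit_ball_sets sets.Int by metis
    show "0 < e / (C * real k)" using e C k by simp
    fix x assume x: "x \<in> space leb" "\<And>i. i < k \<Longrightarrow> \<bar>x i - v i\<bar> < e / (C * real k)"
    define s where "s = (\<Sum>i<k. \<bar>x i - v i\<bar>)"
    have s0: "0 \<le> s" by (simp add: s_def sum_nonneg)
    have "s < (\<Sum>i<k. e / (C * real k))"
      unfolding s_def using x k by (intro sum_strict_mono) (auto simp: lessThan_empty_iff)
    then have Cs: "C * s < e" using C k by (simp add: field_simps)
    have N: "\<bar>?N x - ?N v\<bar> \<le> ?N (\<lambda>_. 1) * s"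
      unfolding s_def by (rule fnorm_lipschitz[OF l])
    have R: "\<bar>?R x - ?R v\<bar> \<le> s"
      unfolding s_def by (rule L2_set_lipschitz)
    have dev: "\<bar>(?N x - b * ?R x) - (?N v - b * ?R v)\<bar> < e" if "\<bar>b\<bar> \<le> \<bar>m\<bar> + \<bar>m'\<bar>" for b
    proof -
      have "\<bar>b * (?R x - ?R v)\<bar> \<le> (\<bar>m\<bar> + \<bar>m'\<bar>) * s"
        unfolding abs_mult using R that by (intro mult_mono) auto
      moreover have "C * s = ?N (\<lambda>_. 1) * s + (\<bar>m\<bar> + \<bar>m'\<bar>) * s + s"
        by (simp add: C_def algebra_simps)
      moreover have "(?N x - b * ?R x) - (?N v - b * ?R v) = (?N x - ?N v) - b * (?R x - ?R v)"
        by (simp add: algebra_simps)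
      ultimately show ?thesis using N Cs s0 by linarith
    qed
    have "s \<le> C * s" using C1 s0 mult_right_mono[of 1 C s] by simp
    then have "s < 1 / 4" using Cs by (simp add: e_def)
    then have Rx: "?R x \<le> 1" "0 < ?R x" using R v by auto
    have "m * ?R x < ?N x" "?N x < m' * ?R x"
      using dev[of m] dev[of m'] unfolding e_def by (auto simp: abs_less_iff)
    then show "x \<in> unit_ball \<inter> radial -` {m<..<m'}"
      using Rx x(1) by (simp add: unit_ball_def radial_def field_simps)
  qed
qed auto

text \<open>For two medians m < m', the half-lines below m and above m' have mass at least 1/2 each.
  A point where \<open>radial\<close> is (m + m') / 2 gives the gap positive mass, which exceeds
  total mass 1.\<close>

lemma median_unique:
  assumes "is_median_on_sphere k l m" "is_median_on_sphere k l m'"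
  shows "m = m'"
proof -
  interpret real_distribution radial_law by (rule real_distribution_radial_law)
  have *: False if "m < m'" "is_median_on_sphere k l m" "is_median_on_sphere k l m'" for m m'
  proof -
    have h: "1 / 2 \<le> measure radial_law {..m}" "1 / 2 \<le> measure radial_law {m'..}"
      using that by (simp_all add: is_median_iff)
    have "measure radial_law {..m} > 0" using h by linarith
    then obtain x where x: "L2_set x {..<k} > 0" "radial x \<in> {..m}"
      by (rule exists_nonzero_of_radial_law_pos[rotated]) auto
    have "measure radial_law {m'..} > 0" using h by linarith
    then obtain y where y: "L2_set y {..<k} > 0" "radial y \<in> {m'..}"
      by (rule exists_nonzero_of_radial_law_pos[rotated]) auto
    have "radial x < (m + m') / 2" "(m + m') / 2 < radial y"
      using x y that(1) by auto
    then obtain u where u: "L2_set u {..<k} > 0" "radial u = (m + m') / 2"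
      using x y radial_intermediate_value by metis
    have "0 < measure radial_law {m<..<m'}"
      using u that(1) by (intro radial_law_gap_pos[of u]) auto
    moreover have "measure radial_law ({..m} \<union> {m<..<m'} \<union> {m'..}) =
      measure radial_law {..m} + measure radial_law {m<..<m'} + measure radial_law {m'..}"
      using that(1) by (subst finite_measure_Union; (subst finite_measure_Union)?) auto
    moreover have "measure radial_law ({..m} \<union> {m<..<m'} \<union> {m'..}) \<le> 1"
      by (rule prob_le_1)
    ultimately show False using h by linarith
  qed
  show ?thesis
    using *[of m m'] *[of m' m] assms by (cases m m' rule: linorder_cases) auto
qed

lemma median_on_sphere: "is_median_on_sphere k l (median_on_sphere k l)"
proof -
  interpret real_distribution radial_law by (rule real_distribution_radial_law)
  obtain m where m: "is_median_on_sphere k l m"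
    using median_exists by (auto simp: is_median_iff)
  have "x = m" if "is_median_on_sphere k l x" for x
    using that m by (rule median_unique)
  with m show ?thesis
    unfolding median_on_sphere_def by (rule theI)
qed


section \<open>Most coordinates of a uniform point are of order \<open>1 / sqrt k\<close>\<close>

definition flat_cutoff :: real where
  "flat_cutoff = 1 / (256 * sqrt (real k))"

definition small_on :: "nat set \<Rightarrow> (nat \<Rightarrow> real) set" where
  "small_on S = {x \<in> unit_ball. \<forall>i\<in>S. \<bar>x i\<bar> < flat_cutoff}"

lemma small_on_sets [measurable]: "small_on S \<in> sets leb" if "S \<subseteq> {..<k}"
proof -
  have "finite S" using that finite_subset by blast
  have "small_on S = unit_ball \<inter> {x \<in> space leb. \<forall>i\<in>S. \<bar>x i\<bar> < flat_cutoff}"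
    by (auto simp: small_on_def unit_ball_def)
  moreover have "{x \<in> space leb. \<forall>i\<in>S. \<bar>x i\<bar> < flat_cutoff} \<in> sets leb"
  proof (rule sets.sets_Collect_finite_All[OF _ \<open>finite S\<close>])
    fix i assume "i \<in> S"
    then have [measurable]: "(\<lambda>x. x i) \<in> borel_measurable leb" using that by auto
    show "{x \<in> space leb. \<bar>x i\<bar> < flat_cutoff} \<in> sets leb" by measurable
  qed
  ultimately show ?thesis by auto
qed

text \<open>Stretching the coordinates in \<open>S\<close> by 128 and shrinking the others by 2 keeps \<open>small_on S\<close>
  inside the unit ball.\<close>

lemma emeasure_small_on:
  assumes S: "S \<subseteq> {..<k}" "k \<le> 2 * card S"
  shows "emeasure leb (small_on S) \<le> ennreal (1 / 8 ^ k) * emeasure leb unit_ball"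
proof -
  define c :: "nat \<Rightarrow> real" where "c i = (if i \<in> S then 128 else 1 / 2)" for i
  define T where "T x = (\<lambda>i\<in>{..<k}. c i * x i)" for x
  have fS: "finite S" using S finite_subset by blast
  have prod: "(\<Prod>i<k. c i) = 128 ^ card S * (1 / 2) ^ (k - card S)"
  proof -
    have "(\<Prod>i<k. c i) = (\<Prod>i\<in>S. c i) * (\<Prod>i\<in>{..<k} - S. c i)"
      using S by (subst prod.subset_diff[of S]) (auto simp: mult.commute)
    also have "\<dots> = (\<Prod>i\<in>S. 128) * (\<Prod>i\<in>{..<k} - S. 1 / 2)"
      by (intro arg_cong2[where f = "(*)"] prod.cong) (auto simp: c_def)
    finally show ?thesis using S fS by (simp add: card_Diff_subset)
  qed
  \<comment> \<open>With s = card S \<ge> k/2, the determinant is 2^(7s - (k - s)) = 2^(8s - k), at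
    least 2^(3k). The rate 8^k is there to beat the 2^k sets in the union bound of
    \<open>flat_le_median\<close>.\<close>
  have "(8 :: real) ^ k \<le> (\<Prod>i<k. c i)"
  proof -
    have cS: "card S \<le> k" using card_mono[OF _ S(1)] by simp
    have "(8 :: real) ^ k * 2 ^ (k - card S) \<le> 8 ^ k * 2 ^ card S"
      using S(2) by (intro mult_left_mono power_increasing) auto
    also have "\<dots> = 2 ^ (3 * k + card S)"
      by (simp add: power_add power_mult)
    also have "\<dots> \<le> 2 ^ (7 * card S)"
      using S(2) by (intro power_increasing) auto
    also have "\<dots> = 128 ^ card S" by (simp add: power_mult)
    finally show ?thesis by (simp add: prod power_divide field_simps)
  qed
  have Tsub: "small_on S \<subseteq> T -` unit_ball \<inter> space leb"
  proof
    fix x assume x: "x \<in> small_on S"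
    then have xs: "x \<in> space leb" and n1: "L2_set x {..<k} \<le> 1"
      by (auto simp: small_on_def unit_ball_def)
    have n2: "(\<Sum>i<k. (x i)\<^sup>2) \<le> 1" using n1 by (simp add: L2_set_def)
    \<comment> \<open>The cutoff is such that a coordinate below it, stretched by 128, has square at
      most 1 / (4k).\<close>
    have fc: "flat_cutoff\<^sup>2 * 65536 = 1 / real k"
      using k by (simp add: flat_cutoff_def power_divide power_mult_distrib)
    have le: "(c i * x i)\<^sup>2 \<le> (x i)\<^sup>2 / 4 + 1 / (4 * real k)" if "i < k" for i
    proof (cases "i \<in> S")
      case True
      have "\<bar>x i\<bar>\<^sup>2 \<le> flat_cutoff\<^sup>2"
        using x True by (intro power_mono) (auto simp: small_on_def)
      then have "(c i * x i)\<^sup>2 \<le> 16384 * flat_cutoff\<^sup>2"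
        using True by (simp add: c_def power_mult_distrib)
      also have "\<dots> = 1 / (4 * real k)" using fc by simp
      finally show ?thesis by (simp add: add_increasing)
    next
      case False
      then show ?thesis by (simp add: c_def power_mult_distrib power_divide)
    qed
    have "(\<Sum>i<k. (T x i)\<^sup>2) \<le> (\<Sum>i<k. (x i)\<^sup>2 / 4 + 1 / (4 * real k))"
      by (intro sum_mono) (auto simp: T_def le)
    also have "\<dots> = (\<Sum>i<k. (x i)\<^sup>2) / 4 + 1 / 4"
      using k by (simp add: sum.distrib sum_divide_distrib)
    also have "\<dots> \<le> 1" using n2 by simp
    finally have "L2_set (T x) {..<k} \<le> 1" by (simp add: L2_set_def)
    then show "x \<in> T -` unit_ball \<inter> space leb"
      using xs by (auto simp: unit_ball_def T_def space_PiM)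
  qed
  have Tm: "T \<in> measurable leb leb" unfolding T_def by measurable
  have "ennreal (8 ^ k) * emeasure leb (small_on S) \<le> ennreal (\<Prod>i<k. c i) * emeasure leb (T -` unit_ball \<inter> space leb)"
    using Tsub measurable_sets[OF Tm unit_ball_sets] \<open>8 ^ k \<le> _\<close>
    by (intro mult_mono emeasure_mono ennreal_leI) auto
  also have "\<dots> = emeasure leb unit_ball"
    unfolding T_def by (intro PiM_lborel_scaling[symmetric] unit_ball_sets) (auto simp: c_def)
  finally have "ennreal (1 / 8 ^ k) * (ennreal (8 ^ k) * emeasure leb (small_on S))
    \<le> ennreal (1 / 8 ^ k) * emeasure leb unit_ball"
    by (intro mult_left_mono) auto
  moreover have "ennreal (1 / 8 ^ k) * ennreal (8 ^ k) = 1"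
    by (subst ennreal_mult[symmetric]) auto
  ultimately show ?thesis by (simp add: mult.assoc[symmetric])
qed

lemma measure_small_on:
  assumes S: "S \<subseteq> {..<k}" "k \<le> 2 * card S"
  shows "measure leb (small_on S) \<le> 1 / 8 ^ k * measure leb unit_ball"
proof -
  have "enn2real (emeasure leb (small_on S)) \<le> enn2real (ennreal (1 / 8 ^ k) * emeasure leb unit_ball)"
    using emeasure_small_on[OF S] unit_ball_finite
    by (intro enn2real_mono) (auto simp: ennreal_mult_less_top)
  then show ?thesis by (simp add: measure_def enn2real_mult)
qed

text \<open>The coordinates below the cutoff are less than half of all, so the others form a
  majority \<open>A\<close>. Then |x| dominates the cutoff times the indicator of \<open>A\<close>,
  whose norm is at least half that of the all-ones vector; 512 = 2 * 256.\<close>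

lemma radial_ge_flat:
  assumes x: "x \<in> unit_ball" and big: "\<And>S. S \<subseteq> {..<k} \<Longrightarrow> k \<le> 2 * card S \<Longrightarrow> x \<notin> small_on S"
  shows "fnorm k l (\<lambda>_. 1) / (512 * sqrt (real k)) \<le> radial x"
proof -
  define A where "A = {i \<in> {..<k}. flat_cutoff \<le> \<bar>x i\<bar>}"
  have fc: "flat_cutoff > 0" using k by (simp add: flat_cutoff_def)
  have "x \<in> small_on ({..<k} - A)"
    using x by (auto simp: small_on_def A_def)
  then have n: "\<not> k \<le> 2 * card ({..<k} - A)" using big[OF Diff_subset] by blast
  have A: "A \<subseteq> {..<k}" "finite A" by (auto simp: A_def)
  then have "card ({..<k} - A) = k - card A" by (simp add: card_Diff_subset)
  then have cA: "k \<le> 2 * card A" "card A > 0" using n by linarith+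
  then have "A \<noteq> {}" by auto
  then obtain i where i: "i < k" "flat_cutoff \<le> \<bar>x i\<bar>"
    by (auto simp: A_def)
  have R1: "L2_set x {..<k} \<le> 1" using x by (simp add: unit_ball_def)
  have "L2_set x {..<k} \<noteq> 0"
    using i fc by (auto simp: L2_set_eq_0_iff intro!: bexI[of _ i])
  then have R0: "L2_set x {..<k} > 0" using L2_set_nonneg[of x "{..<k}"] by linarith
  have "fnorm k l (\<lambda>_. 1) \<le> 2 * fnorm k l (\<lambda>i. if i \<in> A then 1 else 0)"
    by (rule fnorm_ones_le_majority[OF l A(1) cA(1)])
  then have "flat_cutoff / 2 * fnorm k l (\<lambda>_. 1) \<le> flat_cutoff / 2 * (2 * fnorm k l (\<lambda>i. if i \<in> A then 1 else 0))"
    using fc by (intro mult_left_mono) auto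
  also have "\<dots> = fnorm k l (\<lambda>i. flat_cutoff * (if i \<in> A then 1 else 0))"
    unfolding fnorm_scale[OF l] using fc by simp
  also have "\<dots> \<le> fnorm k l x"
    using fc by (intro fnorm_mono[OF l]) (auto simp: A_def)
  also have "\<dots> \<le> radial x"
    using R0 R1 fnorm_nonneg[OF l, of x] unfolding radial_def
    by (simp add: pos_le_divide_eq mult_left_le)
  finally show ?thesis by (simp add: flat_cutoff_def)
qed

text \<open>Otherwise the event of mass 1/2 below the median lies in the union of at most 2^k sets
  \<open>small_on S\<close>, each of relative volume at most 8^(-k), hence has probability at most
  4^(-k) \<le> 1/4.\<close>

lemma flat_le_median:
  "fnorm k l (\<lambda>_. 1) \<le> 512 * sqrt (real k) * median_on_sphere k l"
proof (rule ccontr)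
  assume neg: "\<not> fnorm k l (\<lambda>_. 1) \<le> 512 * sqrt (real k) * median_on_sphere k l"
  let ?M = "median_on_sphere k l" and ?J = "{S \<in> Pow {..<k}. k \<le> 2 * card S}"
  have "?M < fnorm k l (\<lambda>_. 1) / (512 * sqrt (real k))"
    using neg k by (simp add: field_simps)
  then have sub1: "unit_ball \<inter> radial -` {..?M} \<subseteq> (\<Union>S\<in>?J. small_on S)"
    using radial_ge_flat by fastforce
  have U: "(\<Union>S\<in>?J. small_on S) \<in> sets leb"
    by (intro sets.finite_UN) (auto intro: small_on_sets)
  have sub: "(\<Union>S\<in>?J. small_on S) \<subseteq> unit_ball"
    by (auto simp: small_on_def)
  have "measure leb (unit_ball \<inter> radial -` {..?M}) \<le> measure leb (\<Union>S\<in>?J. small_on S)"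
  proof (rule measure_mono_fmeasurable[OF sub1])
    have "radial -` {..?M} \<inter> space leb \<in> sets leb" by measurable
    moreover have "unit_ball \<inter> (radial -` {..?M} \<inter> space leb) = unit_ball \<inter> radial -` {..?M}"
      by (auto simp: unit_ball_def)
    ultimately show "unit_ball \<inter> radial -` {..?M} \<in> sets leb"
      using unit_ball_sets sets.Int by metis
    show "(\<Union>S\<in>?J. small_on S) \<in> fmeasurable leb"
      using U le_less_trans[OF emeasure_mono[OF sub unit_ball_sets] unit_ball_finite]
      by (intro fmeasurableI)
  qed
  also have "\<dots> \<le> (\<Sum>S\<in>?J. measure leb (small_on S))"
  proof (rule measure_UNION_le)
    show "small_on S \<in> sets leb" if "S \<in> ?J" for S
      using that by (auto intro: small_on_sets)
  qed auto
  also have "\<dots> \<le> (\<Sum>S\<in>?J. 1 / 8 ^ k * measure leb unit_ball)"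
    by (intro sum_mono measure_small_on) auto
  also have "\<dots> \<le> (\<Sum>S\<in>Pow {..<k}. 1 / 8 ^ k * measure leb unit_ball)"
    by (intro sum_mono2) auto
  also have "\<dots> = (1 / 4) ^ k * measure leb unit_ball"
  proof -
    have "(8 :: real) ^ k = 2 ^ k * 4 ^ k" by (simp flip: power_mult_distrib)
    then show ?thesis by (simp add: card_Pow power_divide)
  qed
  also have "\<dots> \<le> (1 / 4) ^ 1 * measure leb unit_ball"
    using k by (intro mult_right_mono power_decreasing) auto
  finally have "measure radial_law {..?M} \<le> 1 / 4"
    using measure_leb_ball_pos by (simp add: measure_radial_law field_simps)
  then show False using median_on_sphere by (simp add: is_median_iff)
qed

section \<open>A near maximizer on the sphere\<close>

lemma unit_sphere_iff:
  "x \<in> unit_sphere k \<longleftrightarrow> x \<in> carrier_vec k \<and> L2_set (\<lambda>i. x $ i) {..<k} = 1"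
  by (auto simp: unit_sphere_def L2_set_def scalar_prod_def power2_eq_square lessThan_atLeast0)

lemma sphere_le_flat:
  assumes "x \<in> unit_sphere k"
  shows "l x \<le> fnorm k l (\<lambda>_. 1)"
proof -
  have "\<bar>x $ i\<bar> \<le> 1" if "i < k" for i
    using member_le_L2_set[of "{..<k}" i "\<lambda>i. \<bar>x $ i\<bar>"] that assms
    by (simp add: unit_sphere_iff L2_set_def)
  then have "fnorm k l (\<lambda>i. x $ i) \<le> fnorm k l (\<lambda>_. 1)"
    by (intro fnorm_mono[OF l]) auto
  then show ?thesis using assms by (simp add: fnorm_vec_index unit_sphere_iff)
qed

text \<open>A point within a factor 2 of the supremum suffices, which doubles 512 to 1024. The first
  unit vector makes the supremum positive and gives the second bound, which later keeps the entries
  of \<open>z\<close> polynomial.\<close>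

lemma near_maximizer:
  obtains x :: "nat \<Rightarrow> real" where
    "L2_set x {..<k} = 1"
    "fnorm k l (\<lambda>i. if i = 0 then 1 else 0) \<le> 2 * fnorm k l x"
    "0 \<le> mc k l"
    "mc k l * fnorm k l (\<lambda>_. 1) \<le> 1024 * sqrt (real k) * fnorm k l x"
    "fnorm k l x \<le> fnorm k l (\<lambda>_. 1)"
proof -
  let ?L = "fnorm k l (\<lambda>_. 1)" and ?e = "\<lambda>i. if i = (0::nat) then 1 else 0 :: real"
  let ?b = "max_on_sphere k l" and ?M = "median_on_sphere k l"
  have L: "?L > 0" using fnorm_ones_pos[OF l k] .
  have M: "?M > 0"
  proof (rule ccontr)
    assume "\<not> ?M > 0"
    then have "512 * sqrt (real k) * ?M \<le> 0" by (intro mult_nonneg_nonpos) auto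
    then show False using flat_le_median L by linarith
  qed
  have bdd: "bdd_above (l ` unit_sphere k)"
    by (intro bdd_aboveI[of _ ?L]) (auto simp: sphere_le_flat)
  have "(\<Sum>i<k. (Matrix.vec k ?e $ i)\<^sup>2) = (\<Sum>i<k. if i = 0 then 1 else 0)"
    by (intro sum.cong) auto
  also have "\<dots> = 1" using k by simp
  finally have e: "Matrix.vec k ?e \<in> unit_sphere k"
    unfolding unit_sphere_iff L2_set_def by (simp only: real_sqrt_one vec_carrier simp_thms)
  have eb: "fnorm k l ?e \<le> ?b"
    unfolding fnorm_def max_on_sphere_def using e bdd by (rule cSUP_upper)
  have "fnorm k l ?e \<noteq> 0"
    unfolding fnorm_eq_0_iff[OF l] using k by force
  then have "fnorm k l ?e > 0"
    using fnorm_nonneg[OF l, of ?e] by linarith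
  then have b: "?b > 0" using eb by linarith
  then have "?b / 2 < (SUP x\<in>unit_sphere k. l x)" by (simp add: max_on_sphere_def)
  moreover have "unit_sphere k \<noteq> {}" using e by blast
  ultimately obtain x where x: "x \<in> unit_sphere k" "?b / 2 < l x"
    using less_cSUP_iff[OF _ bdd, of "?b / 2"] by auto
  have lx: "fnorm k l (\<lambda>i. x $ i) = l x"
    using x by (simp add: fnorm_vec_index unit_sphere_iff)
  show ?thesis
  proof (rule that[of "\<lambda>i. x $ i"])
    show "0 \<le> mc k l" using b M by (simp add: mc_def)
    have "mc k l * ?L \<le> mc k l * (512 * sqrt (real k) * ?M)"
      using b M by (intro mult_left_mono flat_le_median) (simp add: mc_def)
    also have "\<dots> = 512 * sqrt (real k) * ?b"
      using M by (simp add: mc_def)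
    also have "\<dots> \<le> 512 * sqrt (real k) * (2 * l x)"
      using x by (intro mult_left_mono) auto
    finally show "mc k l * ?L \<le> 1024 * sqrt (real k) * fnorm k l (\<lambda>i. x $ i)"
      by (simp add: lx)
    show "fnorm k l ?e \<le> 2 * fnorm k l (\<lambda>i. x $ i)"
      using eb x by (simp add: lx)
    show "L2_set (\<lambda>i. x $ i) {..<k} = 1"
      using x(1) by (simp add: unit_sphere_iff)
    show "fnorm k l (\<lambda>i. x $ i) \<le> ?L"
      unfolding lx using x(1) by (rule sphere_le_flat)
  qed
qed

end

section \<open>The communication argument for streams\<close>

definition net :: "update list \<Rightarrow> nat \<Rightarrow> int" where
  "net us i = (\<Sum>(j, d) \<leftarrow> us. if j = i then d else 0)"

primrec encode :: "nat \<Rightarrow> (nat \<Rightarrow> int) \<Rightarrow> update list" where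
  "encode 0 v = []"
| "encode (Suc n) v = encode n v @ replicate (nat \<bar>v n\<bar>) (n, if v n < 0 then - 1 else 1)"

lemma net_append: "net (us @ ws) i = net us i + net ws i"
  by (simp add: net_def)

lemma net_encode: "net (encode n v) i = (if i < n then v i else 0)"
proof (induction n)
  case 0
  then show ?case by (simp add: net_def)
next
  case (Suc n)
  have "net (replicate m (n, d)) i = (if i = n then int m * d else 0)" for m d
    by (simp add: net_def sum_list_replicate)
  then show ?case using Suc by (auto simp: net_append less_Suc_eq)
qed

lemma encode_streams: "m \<le> n \<Longrightarrow> encode m v \<in> streams n"
  unfolding streams_def by (induction m) auto

lemma stream_vec_real:
  "l (map_vec real_of_int (stream_vec n us)) = fnorm n l (\<lambda>i. real_of_int (net us i))"
  unfolding fnorm_def by (intro arg_cong[of _ _ l] eq_vecI) (auto simp: stream_vec_def net_def)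

lemma run_from_append:
  "run_from A r m (us @ ws) = bind_pmf (run_from A r m us) (\<lambda>m'. run_from A r m' ws)"
  by (induction us arbitrary: m) (simp_all add: bind_return_pmf bind_assoc_pmf)

lemma memory_after_append:
  "memory_after A r (us @ ws) = bind_pmf (memory_after A r us) (\<lambda>m. run_from A r m ws)"
  by (simp add: memory_after_def run_from_append bind_assoc_pmf)

lemma prob_bind_pmf:
  "measure_pmf.prob (bind_pmf p f) E = measure_pmf.expectation p (\<lambda>x. measure_pmf.prob (f x) E)"
proof -
  have "ennreal (measure_pmf.prob (bind_pmf p f) E) = (\<integral>\<^sup>+x. ennreal (measure_pmf.prob (f x) E) \<partial>measure_pmf p)"
    by (simp flip: measure_pmf.emeasure_eq_measure)
  also have "\<dots> = ennreal (measure_pmf.expectation p (\<lambda>x. measure_pmf.prob (f x) E))"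
    by (intro nn_integral_eq_integral measure_pmf.integrable_const_bound[where B = 1]) auto
  finally show ?thesis by (simp add: integral_nonneg)
qed

text \<open>Contents of all lengths up to \<open>s\<close> count as different, hence
  2^(s+1).\<close>

lemma card_memories: "card {m :: memory. length m \<le> s} \<le> 2 ^ (s + 1)"
proof -
  have "card {m :: memory. length m \<le> s} = (\<Sum>i\<le>s. 2 ^ i)"
    using card_lists_length_le[of "UNIV :: bool set" s] by simp
  also have "\<dots> < 2 ^ (s + 1)"
    by (induction s) auto
  finally show ?thesis by simp
qed

lemma finite_memories: "finite {m :: memory. length m \<le> s}"
  using finite_lists_length_le[of "UNIV :: bool set" s] by simp

text \<open>With no memory the answers to the empty stream and to a single update have the same law.
  The zero vector demands the answer 0, and a nonzero vector demands a positive answer. The bound s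
  \<ge> 1 later absorbs additive constants.\<close>

lemma space_pos:
  assumes n: "n \<ge> 1" and l: "symmetric_norm n l" and B: "1 \<le> B"
    and solves: "solves_norm_approx n l B (1 / 6) (99 / 100) A"
    and space: "space_at_most n A s"
  shows "s \<ge> 1"
proof (rule ccontr)
  assume "\<not> s \<ge> 1"
  then have "s = 0" by simp
  let ?us = "[(0, 1)] :: update list"
  have mem: "memory_after A r us = return_pmf []" if "r \<in> set_pmf (tape A)" "us \<in> streams n" for r us
  proof -
    have "set_pmf (memory_after A r us) \<subseteq> {[]}"
      using space that \<open>s = 0\<close> unfolding space_at_most_def by (auto simp: subset_iff)
    then show ?thesis by (simp add: set_pmf_subset_singleton)
  qed
  have str: "[] \<in> streams n" "?us \<in> streams n" using n by (auto simp: streams_def)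
  have same: "answer A [] = answer A ?us"
    unfolding answer_def using mem[OF _ str(1)] mem[OF _ str(2)] by (intro bind_pmf_cong) auto
  let ?v = "\<lambda>us. l (map_vec real_of_int (stream_vec n us))"
  have v0: "?v [] = 0"
    unfolding stream_vec_real by (simp add: net_def fnorm_zero[OF l])
  have "?v ?us \<noteq> 0"
    unfolding stream_vec_real fnorm_eq_0_iff[OF l] using n by (force simp: net_def)
  moreover have "0 \<le> ?v ?us"
    unfolding stream_vec_real by (rule fnorm_nonneg[OF l])
  ultimately have v1: "?v ?us > 0" by linarith
  let ?E = "\<lambda>us. {a. approximates (1 / 6) a (?v us)}"
  have "measure_pmf.prob (answer A []) (?E []) \<ge> 99 / 100"
    using solves str B unfolding solves_norm_approx_def by (auto simp: stream_vec_def)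
  moreover have "measure_pmf.prob (answer A ?us) (?E ?us) \<ge> 99 / 100"
    using solves str B unfolding solves_norm_approx_def by (auto simp: stream_vec_def)
  moreover have "measure_pmf.prob (answer A ?us) (?E [] \<union> ?E ?us)
    = measure_pmf.prob (answer A ?us) (?E []) + measure_pmf.prob (answer A ?us) (?E ?us)"
    using v0 v1 by (intro measure_pmf.finite_measure_Union) (auto simp: approximates_def)
  moreover have "measure_pmf.prob (answer A ?us) (?E [] \<union> ?E ?us) \<le> 1"
    by (rule measure_pmf.prob_le_1)
  ultimately show False by (simp add: same)
qed


text \<open>To accept means to answer at most \<open>T\<close>. The final vector is minus the
  indicator of \<open>S\<close> in the first case and minus (indicator + signed shift) in the
  second, so the acceptance probabilities differ by at least p - (1 - p).\<close>

lemma distinguishing_bound: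
  fixes T p :: real and z :: "nat \<Rightarrow> nat"
  assumes k: "k \<ge> 1" "k \<le> n" and space: "space_at_most n A s"
  defines "acc \<equiv> \<lambda>x y. measure_pmf.prob (answer A (encode n x @ encode n (- y))) {..T}"
  assumes accept: "\<And>y S. y \<in> lattice_box k k \<Longrightarrow> S \<subseteq> {..<k} \<Longrightarrow> p \<le> acc (y - indic S) y"
    and reject: "\<And>y S c S'. y \<in> lattice_box k k \<Longrightarrow> S \<subseteq> {..<k} \<Longrightarrow>
      acc (y - indic S) (y + signed_shift k z c S') \<le> 1 - p"
  shows "2 * p - 1 \<le> 1 / 2 + 2 * (\<Sum>i<k. (real (z i))\<^sup>2) / k * (4 * ln (2 ^ (s + 1)) + 2)"
proof -
  let ?B = "lattice_box k (int k)" and ?\<Omega> = "{m :: memory. length m \<le> s}"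
  define P where "P r x m = pmf (memory_after A r (encode n x)) m" for r x m
  define Q where "Q r y m = measure_pmf.prob (bind_pmf (run_from A r m (encode n (- y))) (emit A r)) {..T}" for r y m
  define a where "a r x y = measure_pmf.prob (bind_pmf (memory_after A r (encode n x @ encode n (- y))) (emit A r)) {..T}" for r x y
  define \<delta> where "\<delta> = 1 / 2 + 2 * (\<Sum>i<k. (real (z i))\<^sup>2) / k * (4 * ln (2 ^ (s + 1)) + 2)"
  \<comment> \<open>\<open>a0\<close> and \<open>a1\<close> average the acceptance probability over
    all random choices in the unshifted and the shifted case.\<close>
  define a0 where "a0 g = (\<Sum>y\<in>?B. avg {..<k} (\<lambda>S. g (y - indic S) y)) / k ^ k" for g :: "(nat \<Rightarrow> int) \<Rightarrow> (nat \<Rightarrow> int) \<Rightarrow> real"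
  define a1 where "a1 g = (\<Sum>c<k. avg {..<k} (\<lambda>S'. \<Sum>y\<in>?B. avg {..<k} (\<lambda>S. g (y - indic S) (y + signed_shift k z c S')))) / (k * k ^ k)" for g :: "(nat \<Rightarrow> int) \<Rightarrow> (nat \<Rightarrow> int) \<Rightarrow> real"
  have fixed_tape: "a0 (a r) - a1 (a r) \<le> \<delta>" if r: "r \<in> set_pmf (tape A)" for r
  proof -
    have sub: "set_pmf (memory_after A r (encode n x)) \<subseteq> ?\<Omega>" for x
      using space r encode_streams[of n n x] unfolding space_at_most_def by auto
    have Psum: "(\<Sum>m\<in>?\<Omega>. P r x m) = 1" for x
      unfolding P_def by (intro sum_pmf_eq_1 finite_memories sub)
    \<comment> \<open>Once the tape is fixed, the second part depends on the first only through the
      memory content, which separates \<open>P\<close> from \<open>Q\<close>.\<close>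
    have a_eq: "a r x y = (\<Sum>m\<in>?\<Omega>. P r x m * Q r y m)" for x y
    proof -
      have "a r x y = measure_pmf.expectation (memory_after A r (encode n x)) (Q r y)"
        unfolding a_def memory_after_append bind_assoc_pmf prob_bind_pmf[of "memory_after A r (encode n x)"] Q_def ..
      also have "\<dots> = (\<Sum>m\<in>?\<Omega>. P r x m * Q r y m)"
        unfolding P_def using sub by (subst integral_measure_pmf[OF finite_memories]) auto
      finally show ?thesis .
    qed
    have swap: "(\<Sum>m\<in>?\<Omega>. cube_average k (P r) y m * Q r y' m) = avg {..<k} (\<lambda>S. a r (y - indic S) y')" for y y'
      unfolding cube_average_def a_eq avg_sum
      by (intro sum.cong refl) (simp add: avg_cmult mult.commute)
    have card: "real (card ?\<Omega>) \<le> 2 ^ (s + 1)"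
      using card_memories[of s] by (metis of_nat_le_iff of_nat_numeral of_nat_power)
    have "0 \<le> P r x m" "0 \<le> Q r x m" "Q r x m \<le> 1" for x m
      by (simp_all add: P_def Q_def)
    from average_test_difference_le[where P = "P r" and Q = "Q r" and z = z,
        OF k(1) finite_memories this(1) Psum card this(2,3)]
    show ?thesis
      unfolding swap a0_def a1_def \<delta>_def by simp
  qed
  \<comment> \<open>The bound holds for each tape in the support, and now both sides are averaged
    over the tape.\<close>
  have int: "integrable (measure_pmf (tape A)) (\<lambda>r. a r x y)" for x y
    by (intro measure_pmf.integrable_const_bound[where B = 1]) (auto simp: a_def)
  have E: "measure_pmf.expectation (tape A) (\<lambda>r. a r x y) = acc x y" for x y
    unfolding acc_def a_def answer_def by (simp only: prob_bind_pmf[of "tape A"])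
  have E0: "measure_pmf.expectation (tape A) (\<lambda>r. a0 (a r)) = a0 acc"
    unfolding a0_def avg_def by (simp add: int E)
  have E1: "measure_pmf.expectation (tape A) (\<lambda>r. a1 (a r)) = a1 acc"
    unfolding a1_def avg_def by (simp add: int E)
  have i0: "integrable (measure_pmf (tape A)) (\<lambda>r. a0 (a r))"
    unfolding a0_def avg_def by (intro integrable_divide_zero Bochner_Integration.integrable_sum int)
  have i1: "integrable (measure_pmf (tape A)) (\<lambda>r. a1 (a r))"
    unfolding a1_def avg_def by (intro integrable_divide_zero Bochner_Integration.integrable_sum int)
  have "a0 acc - a1 acc = measure_pmf.expectation (tape A) (\<lambda>r. a0 (a r) - a1 (a r))"
    using i0 i1 by (simp add: E0 E1)
  also have "\<dots> \<le> measure_pmf.expectation (tape A) (\<lambda>_. \<delta>)"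
    using i0 i1 fixed_tape by (intro integral_mono_AE) (auto simp: AE_measure_pmf_iff)
  finally have "a0 acc - a1 acc \<le> \<delta>" by simp
  moreover have "p \<le> a0 acc"
  proof -
    have "p * k ^ k = (\<Sum>y\<in>?B. avg {..<k} (\<lambda>_. p))"
      by (simp add: avg_const card_lattice_box)
    also have "\<dots> \<le> (\<Sum>y\<in>?B. avg {..<k} (\<lambda>S. acc (y - indic S) y))"
      by (intro sum_mono avg_mono accept)
    finally show ?thesis using k by (simp add: a0_def pos_le_divide_eq)
  qed
  moreover have "a1 acc \<le> 1 - p"
  proof -
    have "(\<Sum>c<k. avg {..<k} (\<lambda>S'. \<Sum>y\<in>?B. avg {..<k} (\<lambda>S. acc (y - indic S) (y + signed_shift k z c S'))))
      \<le> (\<Sum>c<k. avg {..<k} (\<lambda>S'. \<Sum>y\<in>?B. avg {..<k} (\<lambda>S. 1 - p)))"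
      by (intro sum_mono avg_mono reject)
    also have "\<dots> = (1 - p) * (k * k ^ k)"
      by (simp add: avg_const card_lattice_box)
    finally show ?thesis using k by (simp add: a1_def pos_divide_le_eq)
  qed
  ultimately show ?thesis by (simp add: \<delta>_def)
qed

text \<open>Applies \<open>distinguishing_bound\<close> to a rounded multiple of a near maximizer.
  The assumption n \<ge> 2 leaves room for its entries below n^5.\<close>

lemma space_lower_bound_at:
  assumes n: "n \<ge> 2" and k: "1 \<le> k" "k \<le> n" and sym: "symmetric_norm n l"
    and solves: "solves_norm_approx n l (real n powr 5) (1 / 6) (99 / 100) A"
    and space: "space_at_most n A s" and s: "s \<ge> 1"
  shows "real s \<ge> 1 / 10 ^ 9 * (mc k (restrict_norm n l k))\<^sup>2"
proof -
  let ?l = "restrict_norm n l k"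
  let ?N = "fnorm k ?l"
  have symk: "symmetric_norm k ?l" by (rule symmetric_norm_restrict_norm[OF sym k(2)])
  define L where "L = ?N (\<lambda>_. 1)"
  have L: "L > 0" unfolding L_def by (rule fnorm_ones_pos[OF symk k(1)])
  obtain x where x: "L2_set x {..<k} = 1"
    "?N (\<lambda>i. if i = 0 then 1 else 0) \<le> 2 * ?N x"
    "0 \<le> mc k ?l" "mc k ?l * L \<le> 1024 * sqrt (real k) * ?N x"
    using near_maximizer[OF symk k(1)] unfolding L_def by metis
  have Le: "L \<le> real k * ?N (\<lambda>i. if i = 0 then 1 else 0)"
    unfolding L_def by (rule fnorm_ones_le[OF symk])
  also have "\<dots> \<le> real k * (2 * ?N x)"
    using x(2) by (intro mult_left_mono) auto
  finally have Lx: "L \<le> 2 * real k * ?N x" by simp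
  have Nx: "?N x > 0"
  proof (rule ccontr)
    assume "\<not> ?N x > 0"
    then have "2 * real k * ?N x \<le> 0" by (intro mult_nonneg_nonpos) auto
    then show False using Lx L by linarith
  qed
  \<comment> \<open>The norm of \<alpha> x is 4L: rounding costs at most L, and adding a 0/1 vector
    costs at most L again, so at least 2L remains.\<close>
  define \<alpha> where "\<alpha> = 4 * L / ?N x"
  have \<alpha>: "0 < \<alpha>" "\<alpha> \<le> 8 * real k"
    using Lx L Nx by (auto simp: \<alpha>_def pos_divide_le_eq)
  define z where "z i = nat \<lfloor>\<alpha> * \<bar>x i\<bar>\<rfloor>" for i
  have zr: "real (z i) = of_int \<lfloor>\<alpha> * \<bar>x i\<bar>\<rfloor>" for i
    using \<alpha> by (simp add: z_def)
  have z_le: "real (z i) \<le> \<alpha> * \<bar>x i\<bar>" and z_ge: "\<alpha> * \<bar>x i\<bar> \<le> real (z i) + 1" for i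
    unfolding zr by linarith+
  have z_small: "real (z i) \<le> 8 * real n" if "i < k" for i
  proof -
    have "\<bar>x i\<bar> \<le> L2_set (\<lambda>i. \<bar>x i\<bar>) {..<k}"
      using that by (intro member_le_L2_set) auto
    also have "\<dots> = 1" using x(1) by (simp add: L2_set_def)
    finally have "\<alpha> * \<bar>x i\<bar> \<le> \<alpha> * 1"
      using \<alpha> by (intro mult_left_mono) auto
    then show ?thesis using z_le[of i] \<alpha>(2) k by simp
  qed
  have z_sum: "(\<Sum>i<k. (real (z i))\<^sup>2) \<le> \<alpha>\<^sup>2"
  proof -
    have "(\<Sum>i<k. (real (z i))\<^sup>2) \<le> (\<Sum>i<k. (\<alpha> * \<bar>x i\<bar>)\<^sup>2)"
      by (intro sum_mono power_mono z_le) auto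
    also have "\<dots> = \<alpha>\<^sup>2 * (\<Sum>i<k. (x i)\<^sup>2)"
      by (simp add: power_mult_distrib sum_distrib_left)
    also have "(\<Sum>i<k. (x i)\<^sup>2) = 1" using x(1) by (simp add: L2_set_def)
    finally show ?thesis by simp
  qed
  have z_norm: "3 * L \<le> ?N (\<lambda>i. real (z i))"
  proof -
    have "4 * L = \<alpha> * ?N x" using Nx by (simp add: \<alpha>_def)
    also have "\<dots> = ?N (\<lambda>i. \<alpha> * x i)"
      using \<alpha> by (simp add: fnorm_scale[OF symk])
    also have "\<dots> \<le> ?N (\<lambda>i. real (z i) + 1)"
      using \<alpha> z_ge by (intro fnorm_mono[OF symk]) (simp add: abs_mult)
    also have "\<dots> \<le> ?N (\<lambda>i. real (z i)) + L"
      unfolding L_def by (rule fnorm_triangle[OF symk])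
    finally show ?thesis by simp
  qed
  have shift_norm: "3 * L \<le> ?N (\<lambda>i. real_of_int (signed_shift k z c S i))" for c S
  proof -
    define p where "p i = (if i < k then (c + i) mod k else i)" for i
    have "bij_betw p {..<k} {..<k}"
      using bij_cyclic[of c k] bij_betw_cong[of "{..<k}" p "\<lambda>i. (c + i) mod k" "{..<k}"] by (simp add: p_def)
    then have p: "p permutes {..<k}"
      by (intro bij_imp_permutes) (auto simp: p_def)
    have "?N (\<lambda>i. real_of_int (signed_shift k z c S i)) = ?N (\<lambda>i. real (z (p i)))"
      by (intro fnorm_sign_change[OF symk]) (simp add: signed_shift_def p_def add.commute)
    also have "\<dots> = ?N (\<lambda>i. real (z i))"
      by (rule fnorm_permute[OF symk p])
    finally show ?thesis using z_norm by simp
  qed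
  have indic_norm: "?N (\<lambda>i. real_of_int (indic S i)) \<le> L" for S
    unfolding L_def by (intro fnorm_mono[OF symk]) (simp add: indic_def)
  have n5: "8 * real n + 1 \<le> real n powr 5"
  proof -
    have "8 * real n + 1 \<le> 16 * real n" using n by simp
    also have "\<dots> \<le> real n ^ 4 * real n"
      using power_mono[of 2 "real n" 4] n by (intro mult_right_mono) auto
    also have "\<dots> = real n powr 5"
      using n powr_realpow[of "real n" 5] by (simp add: power_Suc2[symmetric] del: power_Suc)
    finally show ?thesis .
  qed
  \<comment> \<open>The streams below produce \<open>- w\<close>, which has the same norm as
    \<open>w\<close>. As \<open>w\<close> vanishes from \<open>k\<close> on, its norm is that of the
    restriction to R^k.\<close>
  have answers: "measure_pmf.prob (answer A us) {a. approximates (1 / 6) a (?N (\<lambda>i. real_of_int (w i)))} \<ge> 99 / 100"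
    if us: "us \<in> streams n" and net: "\<And>i. i < n \<Longrightarrow> net us i = - w i"
      and w0: "\<And>i. k \<le> i \<Longrightarrow> w i = 0" and w_small: "\<And>i. i < k \<Longrightarrow> \<bar>w i\<bar> \<le> 8 * int n + 1" for us w
  proof -
    have "\<bar>real_of_int (stream_vec n us $ i)\<bar> \<le> real n powr 5" if i: "i < n" for i
    proof -
      have "\<bar>w i\<bar> \<le> 8 * int n + 1"
        using w0[of i] w_small[of i] by (cases "i < k") auto
      then have "real_of_int \<bar>w i\<bar> \<le> real_of_int (8 * int n + 1)"
        by (simp only: of_int_le_iff)
      moreover have "stream_vec n us $ i = - w i"
        using net[OF i] i by (simp add: stream_vec_def net_def)
      ultimately show ?thesis using n5 by simp
    qed
    then have "measure_pmf.prob (answer A us) {a. approximates (1 / 6) a (l (map_vec real_of_int (stream_vec n us)))} \<ge> 99 / 100"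
      using solves us unfolding solves_norm_approx_def by blast
    also have "l (map_vec real_of_int (stream_vec n us)) = fnorm n l (\<lambda>i. if i < k then - real_of_int (w i) else 0)"
      unfolding stream_vec_real using w0 by (intro fnorm_cong) (simp add: net)
    also have "\<dots> = ?N (\<lambda>i. - real_of_int (w i))"
      using k by (simp add: fnorm_restrict_norm)
    also have "\<dots> = ?N (\<lambda>i. real_of_int (w i))"
      by (intro fnorm_sign_change[OF symk]) simp
    finally show ?thesis .
  qed
  have str: "encode n v @ encode n v' \<in> streams n" for v v'
    using encode_streams[of n n v] encode_streams[of n n v'] by (auto simp: streams_def)
  have "2 * (99 / 100) - 1 \<le> 1 / 2 + 2 * (\<Sum>i<k. (real (z i))\<^sup>2) / k * (4 * ln (2 ^ (s + 1)) + 2)"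
  \<comment> \<open>The threshold separates the two cases: norm at most L gives answers up to 7/6 L,
    norm at least 2L gives answers from 5/6 * 2L = 5/3 L.\<close>
  proof (rule distinguishing_bound[OF k space, where T = "7 / 6 * L"])
    fix y and S :: "nat set" assume S: "S \<subseteq> {..<k}"
    let ?us = "encode n (y - indic S) @ encode n (- y)"
    have "99 / 100 \<le> measure_pmf.prob (answer A ?us) {a. approximates (1 / 6) a (?N (\<lambda>i. real_of_int (indic S i)))}"
      using S by (intro answers str) (auto simp: net_append net_encode indic_def)
    also have "\<dots> \<le> measure_pmf.prob (answer A ?us) {..7 / 6 * L}"
      using indic_norm[of S] by (intro measure_pmf.finite_measure_mono) (auto simp: approximates_def)
    finally show "99 / 100 \<le> measure_pmf.prob (answer A ?us) {..7 / 6 * L}" .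
  next
    fix y and S S' :: "nat set" and c assume S: "S \<subseteq> {..<k}"
    let ?Z = "signed_shift k z c S'"
    let ?us = "encode n (y - indic S) @ encode n (- (y + ?Z))"
    let ?w = "\<lambda>i. indic S i + ?Z i"
    have small: "\<bar>?w i\<bar> \<le> 8 * int n + 1" if "i < k" for i
    proof -
      have "(i + c) mod k < k" using that by simp
      from z_small[OF this] have "z ((i + c) mod k) \<le> 8 * n" by linarith
      then show ?thesis by (auto simp: indic_def signed_shift_def)
    qed
    have 1: "99 / 100 \<le> measure_pmf.prob (answer A ?us) {a. approximates (1 / 6) a (?N (\<lambda>i. real_of_int (?w i)))}"
      using S small by (intro answers str) (auto simp: net_append net_encode indic_def signed_shift_def)
    have "3 * L \<le> ?N (\<lambda>i. real_of_int (?w i) + - real_of_int (indic S i))"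
      using shift_norm[of c S'] by simp
    also have "\<dots> \<le> ?N (\<lambda>i. real_of_int (?w i)) + ?N (\<lambda>i. - real_of_int (indic S i))"
      by (rule fnorm_triangle[OF symk])
    also have "?N (\<lambda>i. - real_of_int (indic S i)) = ?N (\<lambda>i. real_of_int (indic S i))"
      by (intro fnorm_sign_change[OF symk]) simp
    finally have "2 * L \<le> ?N (\<lambda>i. real_of_int (?w i))"
      using indic_norm[of S] by linarith
    then have "{a. approximates (1 / 6) a (?N (\<lambda>i. real_of_int (?w i)))} \<subseteq> - {..7 / 6 * L}"
      using L by (auto simp: approximates_def)
    from measure_pmf.finite_measure_mono[OF this, of "answer A ?us"]
    have "99 / 100 \<le> measure_pmf.prob (answer A ?us) (- {..7 / 6 * L})"
      using 1 by simp
    also have "\<dots> = 1 - measure_pmf.prob (answer A ?us) {..7 / 6 * L}"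
      using measure_pmf.prob_compl[of "{..7 / 6 * L}" "answer A ?us"] by (simp add: Compl_eq_Diff_UNIV)
    finally show "measure_pmf.prob (answer A ?us) {..7 / 6 * L} \<le> 1 - 99 / 100" by simp
  qed
  also have "\<dots> \<le> 1 / 2 + 2 * \<alpha>\<^sup>2 / k * (10 * real s)"
  proof (intro add_left_mono mult_mono divide_right_mono)
    have "ln (2 ^ (s + 1)) = (real s + 1) * ln (2 :: real)"
      by (simp add: ln_mult ln_realpow algebra_simps)
    also have "\<dots> \<le> (real s + 1) * 1"
      using ln_2_less_1 by (intro mult_left_mono) auto
    finally show "4 * ln (2 ^ (s + 1)) + 2 \<le> 10 * real s"
      using s by simp
    show "0 \<le> 4 * ln (2 ^ (s + 1)) + (2 :: real)"
      using ln_ge_zero[OF one_le_power[of "2 :: real" "s + 1"]] by simp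
  qed (use z_sum in \<open>auto intro!: sum_nonneg\<close>)
  \<comment> \<open>From 98/100 - 1/2 = 48/100, divided by the factor 20.\<close>
  finally have "24 / 1000 * real k \<le> \<alpha>\<^sup>2 * real s"
    using k by (simp add: field_simps)
  then have "24 / 1000 * real k * (?N x)\<^sup>2 \<le> \<alpha>\<^sup>2 * real s * (?N x)\<^sup>2"
    by (rule mult_right_mono) simp
  also have "\<dots> = 16 * L\<^sup>2 * real s"
    using Nx by (simp add: \<alpha>_def power_divide power_mult_distrib)
  finally have "(24 / 1000 * real k * (?N x)\<^sup>2) * (mc k ?l)\<^sup>2 \<le> 16 * L\<^sup>2 * real s * (mc k ?l)\<^sup>2"
    by (rule mult_right_mono) simp
  also have "\<dots> = 16 * real s * (mc k ?l * L)\<^sup>2"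
    by (simp add: power_mult_distrib)
  also have "\<dots> \<le> 16 * real s * (1024 * sqrt (real k) * ?N x)\<^sup>2"
    using x L by (intro mult_left_mono power_mono) auto
  also have "\<dots> = (16777216 * real s) * (real k * (?N x)\<^sup>2)"
    by (simp add: power_mult_distrib)
  finally have "(24 / 1000 * (mc k ?l)\<^sup>2) * (real k * (?N x)\<^sup>2) \<le> (16777216 * real s) * (real k * (?N x)\<^sup>2)"
    by (simp add: algebra_simps)
  then have "24 / 1000 * (mc k ?l)\<^sup>2 \<le> 16777216 * real s"
    using k Nx by (subst (asm) mult_le_cancel_right_pos) auto
  then show ?thesis by simp
qed

text \<open>Dimension 1 needs its own argument, because n^5 = 1 leaves no room for the hard
  streams.\<close>

lemma mc_one_le:
  assumes "symmetric_norm 1 l"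
  shows "0 \<le> mc 1 l" "mc 1 l \<le> 1024"
proof -
  obtain x where x: "0 \<le> mc 1 l" "mc 1 l * fnorm 1 l (\<lambda>_. 1) \<le> 1024 * sqrt (real 1) * fnorm 1 l x"
    "fnorm 1 l x \<le> fnorm 1 l (\<lambda>_. 1)"
    using near_maximizer[OF assms order_refl] by metis
  have "mc 1 l * fnorm 1 l (\<lambda>_. 1) \<le> 1024 * fnorm 1 l (\<lambda>_. 1)"
    using x by simp
  then show "mc 1 l \<le> 1024"
    using fnorm_ones_pos[OF assms] by simp
  show "0 \<le> mc 1 l" by (rule x(1))
qed

theorem theorem1p2:
  shows "\<exists>c C0 :: real. c > 0 \<and> C0 \<ge> 1 \<and>
    (\<forall>n \<ge> 1. \<forall>l A s. symmetric_norm n l \<longrightarrow>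
       solves_norm_approx n l (real n powr C0) (1 / 6) (99 / 100) A \<longrightarrow>
       space_at_most n A s \<longrightarrow>
       real s \<ge> c * (mmc n l)\<^sup>2)"
proof (rule exI[of _ "1 / 10 ^ 9"], rule exI[of _ 5], intro conjI allI impI)
  fix n :: nat and l A s
  assume n: "n \<ge> 1" and sym: "symmetric_norm n l"
    and solves: "solves_norm_approx n l (real n powr 5) (1 / 6) (99 / 100) A"
    and space: "space_at_most n A s"
  have s: "s \<ge> 1"
    using n by (intro space_pos[OF n sym _ solves space] ge_one_powr_ge_zero) auto
  have "mmc n l \<in> (\<lambda>k. mc k (restrict_norm n l k)) ` {1..n}"
    unfolding mmc_def using n by (intro Max_in) auto
  then obtain k where k: "1 \<le> k" "k \<le> n" "mmc n l = mc k (restrict_norm n l k)" by auto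
  show "1 / 10 ^ 9 * (mmc n l)\<^sup>2 \<le> real s"
  \<comment> \<open>For n = 1 the claim reduces to 1024^2 / 10^9 \<le> 1 \<le> s.\<close>
  proof (cases "n = 1")
    case True
    then have "k = 1" using k by simp
    have "symmetric_norm 1 (restrict_norm n l 1)"
      using sym n by (rule symmetric_norm_restrict_norm)
    from mc_one_le[OF this] have "(mmc n l)\<^sup>2 \<le> 1024\<^sup>2"
      unfolding k(3) \<open>k = 1\<close> by (intro power_mono)
    then show ?thesis using s by simp
  next
    case False
    then show ?thesis
      unfolding k(3) using n by (intro space_lower_bound_at[OF _ k(1,2) sym solves space s]) auto
  qed
qed auto

end
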